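(* Let $X$ be a standard Borel space and let $\mathcal{R}$ be a Borel equivalence relation with countable classes on $X$ which is the countable free product of sub-relations $\mathcal{R}_i$ ($i\in I$) defined on Borel subsets $A_i$ of $X$ such that $\bigcup_{i\in I}A_i=X$. For every Borel subset $A$ of $X$, the restriction $\mathcal{R}|_A$ of $\mathcal{R}$ to $A$ admits a decomposition as a countable free product of sub-relations of the form $$\mathcal{R}|_A = \Big(\mathop{\star}_{i \in I}\ \mathop{\star}_{k_i \in K(i)} \mathcal{S}_{k_i}\Big) \star \mathcal{T},$$ where each $K(i)$ is a countable set and, for every $i\in I$ and every $k_i\in K(i)$, there is an element $\phi_{k_i}$ of $[[\mathcal{R}]]$ defined on a Borel subset $A_{k_i}$ of $X$ such that $$\mathcal{S}_{k_i} = \phi_{k_i}^{-1}\, \mathcal{R}_{i}|_{\phi_{k_i}(A_{k_i})}\, \phi_{k_i},$$ and where $\mathcal{T}$ is an arborable (treeable) sub-relation of $\mathcal{R}$. Moreover, for every $i\in I$, the $\mathcal{R}_i$-saturations of the ranges $\phi_{k_i}(A_{k_i})$ of the $\phi_{k_i}$, $k_i\in K(i)$, form a (countable Borel) partition of the domain of definition $A_i$ of $\mathcal{R}_i$. Finally, for every $i\in I$ such that $A_i\cap A$ is nonempty, there exists $k_i\in K(i)$ such that $A_{k_i}=A_i\cap A$ and $\mathcal{S}_{k_i}=\mathcal{R}_i|_{A_i\cap A}$.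
   Context: A sub-relation of $\mathcal{R}$ defined on a Borel subset $B\subset X$ is a Borel equivalence relation on $B$ contained in $\mathcal{R}$. A sub-relation defined on a Borel subset is, when needed (in particular in free products), extended to the ambient space by equality outside that subset. The saturation of a Borel subset under an equivalence relation is the set of points equivalent to some point of it. $[[\mathcal{R}]]$ (the full pseudogroup) is the set of Borel isomorphisms $\phi:B\to C$ between Borel subsets of $X$ whose graph is contained in $\mathcal{R}$. If $\phi:B\to C$ is in $[[\mathcal{R}]]$ and $\mathcal{Q}$ is a sub-relation of $\mathcal{R}$ defined on $C$, then $\phi^{-1}\mathcal{Q}\phi$ is the sub-relation on $B$ for which $x,y\in B$ are equivalent iff $\phi(x),\phi(y)$ are $\mathcal{Q}$-equivalent. Countable free product: a relation $\mathcal{Q}$ is the free product of a countable family of sub-relations $(\mathcal{Q}_j)_{j\in J}$ if $\mathcal{Q}$ is generated by the $\mathcal{Q}_j$ (it is the smallest equivalence relation containing them) and, for every $n\ge 2$ and every $n$-tuple $(x_1,\dots,x_n)$ of points with $x_n=x_1$ and $(x_k,x_{k+1})\in \mathcal{Q}_{j_k}$ for $1\le k\le n-1$, where $j_k\ne j_{k+1}$ for $1\le k\le n-2$, there is $1\le k\le n-1$ with $x_k=x_{k+1}$. A Borel equivalence relation with countable classes on a standard Borel space $Y$ is arborable (treeable) if there is a symmetric Borel subset of $Y\times Y$ disjoint from the diagonal which, seen as a graph on $Y$, is acyclic and whose connected components are exactly the classes of the relation.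
   Formalization: The saturations of the ranges are shown to partition the part of A_i inside the R-saturation of A, not all of A_i; the original clause fails for example when A is empty and A_i is not, and the two agree whenever A_i lies in the R-saturation of A. *)

theory Defs
  imports "HOL-Analysis.Analysis"
begin

text \<open>
  A Borel space is a \<open>'a measure\<close> of which only \<open>space\<close> and \<open>sets\<close> matter.  The carrier may be a
  proper (possibly empty) subset of the type.
\<close>

definition standard_borel_space :: "'a measure \<Rightarrow> bool" where
  "standard_borel_space M \<longleftrightarrow>
     (\<exists>T. completely_metrizable_space T \<and> separable_space T \<and>
          space M = topspace T \<and> sets M = sigma_sets (topspace T) {U. openin T U})"

definition borel_equiv_on :: "'a measure \<Rightarrow> 'a set \<Rightarrow> 'a rel \<Rightarrow> bool" where
  "borel_equiv_on M B Q \<longleftrightarrow> B \<in> sets M \<and> Q \<in> sets (M \<Otimes>\<^sub>M M) \<and> equiv B Q"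

definition countable_classes :: "'a set \<Rightarrow> 'a rel \<Rightarrow> bool" where
  "countable_classes B Q \<longleftrightarrow> (\<forall>x\<in>B. countable (Q `` {x}))"

definition sub_relation :: "'a measure \<Rightarrow> 'a rel \<Rightarrow> 'a set \<Rightarrow> 'a rel \<Rightarrow> bool" where
  "sub_relation M R B Q \<longleftrightarrow> borel_equiv_on M B Q \<and> Q \<subseteq> R"

definition restrict_rel :: "'a rel \<Rightarrow> 'a set \<Rightarrow> 'a rel" where
  "restrict_rel R B = R \<inter> (B \<times> B)"

definition saturation :: "'a rel \<Rightarrow> 'a set \<Rightarrow> 'a set" where
  "saturation Q B = {y. \<exists>x\<in>B. (x, y) \<in> Q}"

text \<open>\<open>full_pseudogroup M R B C \<phi>\<close>: the restriction of \<open>\<phi>\<close> to \<open>B\<close> is an element \<open>B \<rightarrow> C\<close> of \<open>[[R]]\<close>;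
  the values of \<open>\<phi>\<close> outside \<open>B\<close> are irrelevant.\<close>

definition full_pseudogroup ::
  "'a measure \<Rightarrow> 'a rel \<Rightarrow> 'a set \<Rightarrow> 'a set \<Rightarrow> ('a \<Rightarrow> 'a) \<Rightarrow> bool" where
  "full_pseudogroup M R B C \<phi> \<longleftrightarrow>
     B \<in> sets M \<and> C \<in> sets M \<and> bij_betw \<phi> B C \<and>
     \<phi> \<in> measurable (restrict_space M B) (restrict_space M C) \<and>
     inv_into B \<phi> \<in> measurable (restrict_space M C) (restrict_space M B) \<and>
     (\<forall>x\<in>B. (x, \<phi> x) \<in> R)"

definition pullback_rel :: "('a \<Rightarrow> 'a) \<Rightarrow> 'a set \<Rightarrow> 'a rel \<Rightarrow> 'a rel" where
  "pullback_rel \<phi> B Q = {(x, y). x \<in> B \<and> y \<in> B \<and> (\<phi> x, \<phi> y) \<in> Q}"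

definition extend_rel :: "'a set \<Rightarrow> 'a rel \<Rightarrow> 'a rel" where
  "extend_rel Y Q = Q \<union> Id_on Y"

definition generated_equiv :: "'a set \<Rightarrow> 'j set \<Rightarrow> ('j \<Rightarrow> 'a rel) \<Rightarrow> 'a rel \<Rightarrow> bool" where
  "generated_equiv Y J Q E \<longleftrightarrow>
     equiv Y E \<and> (\<forall>j\<in>J. Q j \<subseteq> E) \<and>
     (\<forall>F. equiv Y F \<and> (\<forall>j\<in>J. Q j \<subseteq> F) \<longrightarrow> E \<subseteq> F)"

text \<open>\<open>countable_free_product Y J Q E\<close>: the relation \<open>E\<close> on the ambient set \<open>Y\<close> is the free product of
  the family \<open>(Q j)\<^sub>j\<close>, each \<open>Q j\<close> being extended to \<open>Y\<close> by equality.\<close>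

definition countable_free_product ::
  "'a set \<Rightarrow> 'j set \<Rightarrow> ('j \<Rightarrow> 'a rel) \<Rightarrow> 'a rel \<Rightarrow> bool" where
  "countable_free_product Y J Q E \<longleftrightarrow>
     countable J \<and>
     generated_equiv Y J (\<lambda>j. extend_rel Y (Q j)) E \<and>
     (\<forall>(n::nat) (x :: nat \<Rightarrow> 'a) (j :: nat \<Rightarrow> 'j).
        n \<ge> 2 \<and> x n = x 1 \<and>
        (\<forall>k\<in>{1..n-1}. j k \<in> J \<and> (x k, x (k + 1)) \<in> extend_rel Y (Q (j k))) \<and>
        (\<forall>k\<in>{1..n-2}. j k \<noteq> j (k + 1))
        \<longrightarrow> (\<exists>k\<in>{1..n-1}. x k = x (k + 1)))"

definition acyclic_graph :: "'a rel \<Rightarrow> bool" where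
  "acyclic_graph G \<longleftrightarrow>
     \<not> (\<exists>xs. 3 \<le> length xs \<and> distinct xs \<and>
             (\<forall>m. m + 1 < length xs \<longrightarrow> (xs ! m, xs ! (m + 1)) \<in> G) \<and>
             (last xs, hd xs) \<in> G)"

definition treeable :: "'a measure \<Rightarrow> 'a set \<Rightarrow> 'a rel \<Rightarrow> bool" where
  "treeable M B T \<longleftrightarrow>
     borel_equiv_on M B T \<and> countable_classes B T \<and>
     (\<exists>G. G \<in> sets (M \<Otimes>\<^sub>M M) \<and> G \<subseteq> B \<times> B \<and> sym G \<and> irrefl G \<and> acyclic_graph G \<and>
          (\<forall>x\<in>B. \<forall>y\<in>B. (x, y) \<in> G\<^sup>* \<longleftrightarrow> (x, y) \<in> T))"

definition countable_borel_partition ::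
  "'a measure \<Rightarrow> 'a set \<Rightarrow> 'k set \<Rightarrow> ('k \<Rightarrow> 'a set) \<Rightarrow> bool" where
  "countable_borel_partition M Y K P \<longleftrightarrow>
     countable K \<and> (\<forall>k\<in>K. P k \<in> sets M \<and> P k \<noteq> {}) \<and>
     disjoint_family_on P K \<and> (\<Union>k\<in>K. P k) = Y"

text \<open>
  The iterated product \<open>(\<star>\<^sub>i \<star>\<^sub>k S i k) \<star> T\<close> is the free product of one family, indexed by the pairs
  \<open>(i, k)\<close> with \<open>i \<in> I\<close>, \<open>k \<in> K i\<close> and one extra index \<open>None\<close> for \<open>T\<close>.
\<close>

definition kurosh_index :: "'i set \<Rightarrow> ('i \<Rightarrow> 'k set) \<Rightarrow> ('i \<times> 'k) option set" where
  "kurosh_index I K = insert None (Some ` Sigma I K)"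

definition kurosh_family ::
  "('i \<Rightarrow> 'k \<Rightarrow> 'a rel) \<Rightarrow> 'a rel \<Rightarrow> ('i \<times> 'k) option \<Rightarrow> 'a rel" where
  "kurosh_family S T j = (case j of None \<Rightarrow> T | Some (i, k) \<Rightarrow> S i k)"

text \<open>
  In the decomposition of the restriction of \<open>R\<close> to \<open>A\<close>, all domains lie in \<open>A\<close>, so the ranges of the
  partial isomorphisms lie in the \<open>R\<close>-saturation of \<open>A\<close>.  Hence the \<open>R i\<close>-saturations of the
  ranges can only partition \<open>A i \<inter> saturation R A\<close>.  This is \<open>A i\<close> itself exactly when \<open>A\<close> meets
  the \<open>R\<close>-class of every point of \<open>A i\<close>, in particular when \<open>A\<close> is a complete section; for
  \<open>A = {}\<close> and \<open>A i \<noteq> {}\<close> a partition of all of \<open>A i\<close> is impossible.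
\<close>

end

theory Submission
  imports Defs
begin

text \<open>
  By the Lusin-Novikov theorem \<open>R\<close> is the union of the graphs of Borel maps \<open>f\<^sub>0 = id, f\<^sub>1, \<dots>\<close>, which makes
  all countable choices below Borel.  Every point of the saturation of \<open>A\<close> outside \<open>A\<close> gets a parent
  in one of its \<open>R\<^sub>i\<close>-classes, one level closer to \<open>A\<close>; following parents gives a Borel retraction
  \<open>r\<close> onto \<open>A\<close>.  In each \<open>R\<^sub>i\<close>-class consider the points whose parent does not lie in that class, and
  among them those with \<open>f\<^sub>k (r x) = x\<close>, for the least \<open>k\<close> for which there are any.  On these points
  \<open>r\<close> is injective with inverse \<open>f\<^sub>k\<close>, so they carry a conjugate of a piece of \<open>R\<^sub>i\<close> back to \<open>A\<close>;
  the piece for \<open>k = 0\<close> is \<open>A\<^sub>i \<inter> A\<close> itself.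
  \<open>R\<^sub>i\<close> is the free product of its restrictions to these pieces, of the parent edges inside it, and of
  edges attaching the remaining points to the pieces.  The parent edges of all \<open>R\<^sub>i\<close> together generate
  \<open>r x = r y\<close>; collapsing this relation leaves \<open>R\<close> restricted to \<open>A\<close> as the free product of the
  pieces and of the image \<open>T\<close> of the remaining edges, which form an acyclic graph.
\<close>

section \<open>Analytic sets in Baire space and the Lusin-Novikov theorem\<close>

text \<open>This is a Kurosh subgroup theorem for relations: the parent edges play the maximal tree
  that is contracted, the pieces are the conjugated factors, and \<open>T\<close> is the free part.
  Inside one \<open>R\<^sub>i\<close>-class the parent edges form a forest whose roots are the
  points considered in the overview, the points of \<open>A\<close> included; collapsing the forest
  leaves only these survivors. Survivors in different \<open>R\<^sub>i\<close>-classes can have the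
  same image under \<open>r\<close>, so \<open>r\<close> cannot carry all of them injectively.
  Fixing \<open>k\<close> with \<open>f\<^sub>k (r x) = x\<close> restores injectivity, and letting
  each class keep only the survivors of its own least \<open>k\<close> makes the saturations
  disjoint. Each survivor left over costs one attaching edge, and these edges become
  \<open>T\<close>. Keeping whole blocks rather than one point per class matters, since a Borel
  transversal need not exist. The choice \<open>f\<^sub>0 = id\<close> is what makes
  \<open>k = 0\<close> produce all of \<open>A\<^sub>i \<inter> A\<close>.\<close>

type_synonym baire = "nat \<Rightarrow> nat"

section \<open>Closedness and continuity in Baire space through finite agreement\<close>

definition agree :: "nat \<Rightarrow> baire \<Rightarrow> baire \<Rightarrow> bool" where
  "agree n x y \<longleftrightarrow> (\<forall>i<n. x i = y i)"

lemma agree_mono: "agree m x y \<Longrightarrow> n \<le> m \<Longrightarrow> agree n x y"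
  by (auto simp: agree_def)

text \<open>Digit \<open>i\<close> is frozen from stage \<open>Suc i\<close> on, so the diagonal is
  the limit of the sequence.\<close>

lemma agree_limit:
  assumes "\<And>n. agree n (f n) (f (Suc n))"
  shows "agree n (f n) (\<lambda>i. f (Suc i) i)"
proof -
  have *: "f (n + k) i = f n i" if "i < n" for n k i
  proof (induction k)
    case (Suc k)
    have "f (Suc (n + k)) i = f (n + k) i"
      using assms[of "n + k"] that by (auto simp: agree_def)
    then show ?case using Suc by simp
  qed simp
  show ?thesis
    unfolding agree_def
  proof (intro allI impI)
    fix i assume "i < n"
    then show "f n i = f (Suc i) i"
      using *[of i "Suc i" "n - Suc i"] by simp
  qed
qed

text \<open>The complement is open in the product topology, tested on cylinders of equal depth in
  both coordinates.\<close>

definition closed_rel :: "(baire \<Rightarrow> baire \<Rightarrow> bool) \<Rightarrow> bool" where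
  "closed_rel C \<longleftrightarrow>
     (\<forall>x z. \<not> C x z \<longrightarrow> (\<exists>n. \<forall>x' z'. agree n x x' \<longrightarrow> agree n z z' \<longrightarrow> \<not> C x' z'))"

definition cont2 :: "(baire \<Rightarrow> baire \<Rightarrow> baire) \<Rightarrow> bool" where
  "cont2 \<rho> \<longleftrightarrow>
     (\<forall>x z n. \<exists>m. \<forall>x' z'. agree m x x' \<longrightarrow> agree m z z' \<longrightarrow> agree n (\<rho> x z) (\<rho> x' z'))"

lemma cont2I:
  assumes "\<And>x z i. \<exists>m. \<forall>x' z'. agree m x x' \<longrightarrow> agree m z z' \<longrightarrow> \<rho> x z i = \<rho> x' z' i"
  shows "cont2 \<rho>"
  unfolding cont2_def
proof (intro allI)
  fix x z n
  show "\<exists>m. \<forall>x' z'. agree m x x' \<longrightarrow> agree m z z' \<longrightarrow> agree n (\<rho> x z) (\<rho> x' z')"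
  proof (induction n)
    case 0
    then show ?case by (simp add: agree_def)
  next
    case (Suc n)
    then obtain m where m: "\<forall>x' z'. agree m x x' \<longrightarrow> agree m z z' \<longrightarrow> agree n (\<rho> x z) (\<rho> x' z')"
      by blast
    obtain m' where m': "\<forall>x' z'. agree m' x x' \<longrightarrow> agree m' z z' \<longrightarrow> \<rho> x z n = \<rho> x' z' n"
      using assms by blast
    have "agree (Suc n) (\<rho> x z) (\<rho> x' z')"
      if "agree (max m m') x x'" "agree (max m m') z z'" for x' z'
    proof -
      have "agree n (\<rho> x z) (\<rho> x' z')" "\<rho> x z n = \<rho> x' z' n"
        using m m' that by (meson agree_mono max.cobounded1 max.cobounded2)+
      then show ?thesis by (auto simp: agree_def less_Suc_eq)
    qed
    then show ?case by blast
  qed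
qed

lemma cont2_reindex_fst: "cont2 (\<lambda>x z i. x (k i))"
  by (rule cont2I, rule_tac x="Suc (k i)" in exI) (simp add: agree_def)

lemma cont2_reindex_snd: "cont2 (\<lambda>x z i. z (k i))"
  by (rule cont2I, rule_tac x="Suc (k i)" in exI) (simp add: agree_def)

lemma cont2_fst: "cont2 (\<lambda>x z. x)"
  using cont2_reindex_fst[of "\<lambda>i. i"] by simp

lemma closed_rel_comp:
  assumes "closed_rel C" "cont2 \<rho>" "cont2 \<tau>"
  shows "closed_rel (\<lambda>x z. C (\<rho> x z) (\<tau> x z))"
  unfolding closed_rel_def
proof (intro allI impI)
  fix x z assume "\<not> C (\<rho> x z) (\<tau> x z)"
  then obtain n where n: "\<forall>x' z'. agree n (\<rho> x z) x' \<longrightarrow> agree n (\<tau> x z) z' \<longrightarrow> \<not> C x' z'"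
    using assms(1) unfolding closed_rel_def by blast
  obtain m where m: "\<forall>x' z'. agree m x x' \<longrightarrow> agree m z z' \<longrightarrow> agree n (\<rho> x z) (\<rho> x' z')"
    using assms(2) unfolding cont2_def by blast
  obtain k where k: "\<forall>x' z'. agree k x x' \<longrightarrow> agree k z z' \<longrightarrow> agree n (\<tau> x z) (\<tau> x' z')"
    using assms(3) unfolding cont2_def by blast
  show "\<exists>n. \<forall>x' z'. agree n x x' \<longrightarrow> agree n z z' \<longrightarrow> \<not> C (\<rho> x' z') (\<tau> x' z')"
    by (rule exI[of _ "max m k"]) (meson agree_mono max.cobounded1 max.cobounded2 n m k)
qed

lemma closed_rel_All:
  assumes "\<And>k. closed_rel (C k)"
  shows "closed_rel (\<lambda>x z. \<forall>k. C k x z)"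
  using assms unfolding closed_rel_def by meson

lemma closed_rel_conj:
  assumes "closed_rel C" "closed_rel C'"
  shows "closed_rel (\<lambda>x z. C x z \<and> C' x z)"
  using assms unfolding closed_rel_def by meson

lemma closed_rel_coord: "closed_rel (\<lambda>x z. x i \<in> U)"
  unfolding closed_rel_def by (auto simp: agree_def intro!: exI[of _ "Suc i"])

section \<open>Analytic sets and their closure properties\<close>

definition analytic :: "baire set \<Rightarrow> bool" where
  "analytic P \<longleftrightarrow> (\<exists>C. closed_rel C \<and> P = {x. \<exists>z. C x z})"

lemma analyticI: "closed_rel C \<Longrightarrow> (\<And>x. x \<in> P \<longleftrightarrow> (\<exists>z. C x z)) \<Longrightarrow> analytic P"
  unfolding analytic_def by blast

lemma analytic_coord: "analytic {x. x i \<in> U}"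
  by (rule analyticI[OF closed_rel_coord[of i U]]) simp

text \<open>One sequence can hold a witness for every \<open>k\<close>: the witness for
  \<open>P k\<close> is read off the digits \<open>prod_encode (k, m)\<close>.\<close>

lemma analytic_INT:
  assumes "\<And>k::nat. analytic (P k)"
  shows "analytic (\<Inter>k. P k)"
proof -
  obtain C where C: "\<And>k. closed_rel (C k)" "\<And>k. P k = {x. \<exists>z. C k x z}"
    using assms unfolding analytic_def by metis
  have "closed_rel (\<lambda>x z. \<forall>k. C k x (\<lambda>m. z (prod_encode (k, m))))"
    by (intro closed_rel_All closed_rel_comp[OF C(1)] cont2_fst cont2_reindex_snd)
  then show ?thesis
  proof (rule analyticI)
    fix x
    show "x \<in> (\<Inter>k. P k) \<longleftrightarrow> (\<exists>z. \<forall>k. C k x (\<lambda>m. z (prod_encode (k, m))))"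
    proof
      assume "x \<in> (\<Inter>k. P k)"
      then have "\<forall>k. \<exists>z. C k x z" using C(2) by blast
      then obtain Z where Z: "\<And>k. C k x (Z k)" by metis
      show "\<exists>z. \<forall>k. C k x (\<lambda>m. z (prod_encode (k, m)))"
        by (rule exI[of _ "\<lambda>i. case prod_decode i of (k, m) \<Rightarrow> Z k m"]) (simp add: Z)
    next
      assume "\<exists>z. \<forall>k. C k x (\<lambda>m. z (prod_encode (k, m)))"
      then show "x \<in> (\<Inter>k. P k)" using C(2) by blast
    qed
  qed
qed

text \<open>The first digit of the witness names the index \<open>k\<close>, the remaining digits
  witness membership in \<open>P k\<close>. The combined relation is closed because agreement to
  positive depth fixes that index.\<close>

lemma analytic_UN:
  assumes "\<And>k::nat. analytic (P k)"
  shows "analytic (\<Union>k. P k)"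
proof -
  obtain C where C: "\<And>k. closed_rel (C k)" "\<And>k. P k = {x. \<exists>z. C k x z}"
    using assms unfolding analytic_def by metis
  have "closed_rel (\<lambda>x z. C (z 0) x (\<lambda>m. z (Suc m)))"
    unfolding closed_rel_def
  proof (intro allI impI)
    fix x z assume "\<not> C (z 0) x (\<lambda>m. z (Suc m))"
    moreover have "closed_rel (\<lambda>x w. C (z 0) x (\<lambda>m. w (Suc m)))"
      by (intro closed_rel_comp[OF C(1)] cont2_fst cont2_reindex_snd)
    ultimately obtain n where n: "\<forall>x' z'. agree n x x' \<longrightarrow> agree n z z' \<longrightarrow> \<not> C (z 0) x' (\<lambda>m. z' (Suc m))"
      unfolding closed_rel_def by blast
    show "\<exists>n. \<forall>x' z'. agree n x x' \<longrightarrow> agree n z z' \<longrightarrow> \<not> C (z' 0) x' (\<lambda>m. z' (Suc m))"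
    proof (intro exI[of _ "Suc n"] allI impI)
      fix x' z' assume a: "agree (Suc n) x x'" "agree (Suc n) z z'"
      then have "z' 0 = z 0" by (simp add: agree_def)
      moreover have "agree n x x'" "agree n z z'" using a by (auto elim: agree_mono)
      ultimately show "\<not> C (z' 0) x' (\<lambda>m. z' (Suc m))" using n by simp
    qed
  qed
  then show ?thesis
  proof (rule analyticI)
    fix x
    show "x \<in> (\<Union>k. P k) \<longleftrightarrow> (\<exists>z. C (z 0) x (\<lambda>m. z (Suc m)))"
    proof
      assume "x \<in> (\<Union>k. P k)"
      then obtain k z where "C k x z" using C(2) by blast
      then show "\<exists>z. C (z 0) x (\<lambda>m. z (Suc m))"
        by (intro exI[of _ "case_nat k z"]) simp
    next
      assume "\<exists>z. C (z 0) x (\<lambda>m. z (Suc m))"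
      then show "x \<in> (\<Union>k. P k)" using C(2) by blast
    qed
  qed
qed

lemma analytic_Int:
  assumes "analytic P" "analytic Q"
  shows "analytic (P \<inter> Q)"
proof -
  have "analytic (\<Inter>k::nat. (if k = 0 then P else Q))"
    by (rule analytic_INT) (simp add: assms)
  moreover have "(\<Inter>k::nat. (if k = 0 then P else Q)) = P \<inter> Q"
    by (auto split: if_splits)
  ultimately show ?thesis by simp
qed

section \<open>The Borel structure of Baire space\<close>

definition baire_space :: "baire measure" where
  "baire_space = PiM UNIV (\<lambda>_. count_space UNIV)"

lemma space_baire [simp]: "space baire_space = UNIV"
  by (simp add: baire_space_def space_PiM)

lemma measurable_baire_coord [measurable]: "(\<lambda>x. x i) \<in> measurable baire_space (count_space UNIV)"
  unfolding baire_space_def by measurable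

lemma measurable_to_baire:
  assumes "\<And>i. (\<lambda>x. f x i) \<in> measurable M (count_space UNIV)"
  shows "f \<in> measurable M baire_space"
  unfolding baire_space_def by (rule measurable_PiM_single') (use assms in auto)

lemma pred_baire_eq:
  assumes "f \<in> measurable M baire_space" "g \<in> measurable M baire_space"
  shows "Measurable.pred M (\<lambda>x. f x = g x)"
proof -
  have [measurable]: "(\<lambda>x. f x i) \<in> measurable M (count_space UNIV)"
    "(\<lambda>x. g x i) \<in> measurable M (count_space UNIV)" for i
    using measurable_compose[OF assms(1) measurable_baire_coord]
      measurable_compose[OF assms(2) measurable_baire_coord] by auto
  have "(\<lambda>x. f x = g x) = (\<lambda>x. \<forall>i. \<exists>v. f x i = v \<and> g x i = v)"
    by (auto simp: fun_eq_iff)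
  moreover have "Measurable.pred M (\<lambda>x. \<forall>i. \<exists>v. f x i = v \<and> g x i = v)"
    by measurable
  ultimately show ?thesis by metis
qed

lemma analytic_Borel:
  assumes "P \<in> sets baire_space"
  shows "analytic P"
proof -
  let ?G = "{{f \<in> (\<Pi>\<^sub>E i\<in>UNIV. space (count_space UNIV)). f i \<in> A} |i A.
      i \<in> (UNIV::nat set) \<and> A \<in> sets (count_space (UNIV::nat set))}"
  have "P \<in> sigma_sets UNIV ?G"
    using assms unfolding baire_space_def sets_PiM_single by simp
  \<comment> \<open>Analytic sets are not closed under complement, so the induction over generated
    sets carries the complement along.\<close>
  then have "analytic P \<and> analytic (- P)"
  proof (induction rule: sigma_sets.induct)
    case (Basic a)
    then obtain i A where a: "a = {f. f i \<in> A}" by auto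
    then have "- a = {f. f i \<in> - A}" by auto
    with a show ?case using analytic_coord by metis
  next
    case Empty
    show ?case
      using analytic_coord[of 0 "{}"] analytic_coord[of 0 UNIV] by simp
  next
    case (Compl a)
    then show ?case by (simp add: Compl_eq_Diff_UNIV[symmetric])
  next
    case (Union a)
    then show ?case using analytic_UN[of a] analytic_INT[of "\<lambda>i. - a i"] by simp
  qed
  then show ?thesis ..
qed

section \<open>Lusin separation\<close>

definition borel_separated :: "baire set \<Rightarrow> baire set \<Rightarrow> bool" where
  "borel_separated P Q \<longleftrightarrow> (\<exists>B\<in>sets baire_space. P \<subseteq> B \<and> Q \<inter> B = {})"

text \<open>Used contrapositively: an inseparable pair of countable unions contains an inseparable
  pair of members.\<close>

lemma borel_separated_UN:
  fixes P :: "'i::countable \<Rightarrow> baire set" and Q :: "'j::countable \<Rightarrow> baire set"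
  assumes "\<And>m n. borel_separated (P m) (Q n)"
  shows "borel_separated (\<Union>m. P m) (\<Union>n. Q n)"
proof -
  have "\<exists>B. \<forall>m n. B m n \<in> sets baire_space \<and> P m \<subseteq> B m n \<and> Q n \<inter> B m n = {}"
    using assms unfolding borel_separated_def Bex_def by metis
  then obtain B where B: "\<And>m n. B m n \<in> sets baire_space"
    "\<And>m n. P m \<subseteq> B m n" "\<And>m n. Q n \<inter> B m n = {}" by blast
  have "(\<Union>m. \<Inter>n. B m n) \<in> sets baire_space"
    by (rule sets.countable_UN''[OF countableI_type sets.countable_INT''[OF _ countableI_type B(1)]])
      (use sets.top[of baire_space] in simp)
  moreover have "(\<Union>m. P m) \<subseteq> (\<Union>m. \<Inter>n. B m n)"
    by (intro UN_mono order_refl INT_greatest B(2))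
  moreover have "(\<Union>n. Q n) \<inter> (\<Union>m. \<Inter>n. B m n) = {}"
  proof (rule ccontr)
    assume "(\<Union>n. Q n) \<inter> (\<Union>m. \<Inter>n. B m n) \<noteq> {}"
    then obtain x m n where "x \<in> Q n" "x \<in> B m n" by auto
    then show False using B(3)[where m=m and n=n] by blast
  qed
  ultimately show ?thesis unfolding borel_separated_def by blast
qed

text \<open>If no Borel set separates, \<open>borel_separated_UN\<close> yields inseparable parts
  given by longer and longer prefixes of the point and of both witnesses. In the limit one point has
  witnesses for both sets, against disjointness.\<close>

lemma analytic_separation:
  assumes "analytic P" "analytic Q" "P \<inter> Q = {}"
  shows "borel_separated P Q"
proof (rule ccontr)
  assume nsep: "\<not> borel_separated P Q"
  obtain C where C: "closed_rel C" "P = {x. \<exists>z. C x z}" using assms unfolding analytic_def by blast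
  obtain C' where C': "closed_rel C'" "Q = {x. \<exists>z. C' x z}" using assms unfolding analytic_def by blast
  let ?P = "\<lambda>n x0 z0. {x. agree n x0 x \<and> (\<exists>z. agree n z0 z \<and> C x z)}"
  let ?Q = "\<lambda>n x0 z0. {x. agree n x0 x \<and> (\<exists>z. agree n z0 z \<and> C' x z)}"
  let ?N = "\<lambda>n (x0, z0, w0). \<not> borel_separated (?P n x0 z0) (?Q n x0 w0)"
  let ?E = "\<lambda>n (x0, z0, w0) (x1, z1, w1). agree n x0 x1 \<and> agree n z0 z1 \<and> agree n w0 w1"
  have split: "{x. agree n x0 x \<and> (\<exists>z. agree n z0 z \<and> D x z)} =
     (\<Union>(k, m). {x. agree (Suc n) (x0(n := k)) x \<and> (\<exists>z. agree (Suc n) (z0(n := m)) z \<and> D x z)})"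
    for D n and x0 z0 :: baire
    by (fastforce simp: agree_def less_Suc_eq)
  have "\<exists>f. \<forall>n. ?N n (f n) \<and> ?E n (f n) (f (Suc n))"
  proof (rule dependent_nat_choice)
    show "\<exists>x. ?N 0 x"
      using nsep by (auto simp: agree_def C C')
  next
    fix p n
    assume p: "?N n p"
    obtain x0 z0 w0 where p_eq: "p = (x0, z0, w0)" by (cases p)
    have "\<not> borel_separated (\<Union>(k, m). ?P (Suc n) (x0(n := k)) (z0(n := m)))
        (\<Union>(k, m). ?Q (Suc n) (x0(n := k)) (w0(n := m)))"
      using p unfolding p_eq split[symmetric] by simp
    then obtain km km' where "\<not> borel_separated
        (case km of (k, m) \<Rightarrow> ?P (Suc n) (x0(n := k)) (z0(n := m)))
        (case km' of (k, m) \<Rightarrow> ?Q (Suc n) (x0(n := k)) (w0(n := m)))"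
      using borel_separated_UN[where P="\<lambda>(k, m). ?P (Suc n) (x0(n := k)) (z0(n := m))"
          and Q="\<lambda>(k, m). ?Q (Suc n) (x0(n := k)) (w0(n := m))"]
      by blast
    then obtain k m k' m' where km: "\<not> borel_separated
        (?P (Suc n) (x0(n := k)) (z0(n := m))) (?Q (Suc n) (x0(n := k')) (w0(n := m')))"
      by (cases km; cases km') auto
    \<comment> \<open>Both parts must prescribe the same digit of the point, since otherwise the
      clopen set \<open>{x. x n = k}\<close> separates them.\<close>
    have "k = k'"
    proof (rule ccontr)
      assume "k \<noteq> k'"
      moreover have "{x. x n = k} \<in> sets baire_space"
      proof -
        have "{x \<in> space baire_space. x n = k} \<in> sets baire_space" by measurable
        then show ?thesis by simp
      qed
      ultimately have "borel_separated
          (?P (Suc n) (x0(n := k)) (z0(n := m))) (?Q (Suc n) (x0(n := k')) (w0(n := m')))"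
        unfolding borel_separated_def
        by (intro bexI[of _ "{x. x n = k}"]) (auto simp: agree_def)
      with km show False ..
    qed
    then have "?N (Suc n) (x0(n := k), z0(n := m), w0(n := m'))
      \<and> ?E n p (x0(n := k), z0(n := m), w0(n := m'))"
      using km by (simp add: p_eq agree_def)
    then show "\<exists>q. ?N (Suc n) q \<and> ?E n p q" by blast
  qed
  then obtain f where f0: "\<forall>n. ?N n (f n) \<and> ?E n (f n) (f (Suc n))" by (rule exE)
  have f: "?N n (f n)" "?E n (f n) (f (Suc n))" for n
  proof -
    have "?N n (f n) \<and> ?E n (f n) (f (Suc n))" using f0 by (rule spec)
    then show "?N n (f n)" by (rule conjunct1)
    from \<open>?N n (f n) \<and> ?E n (f n) (f (Suc n))\<close> show "?E n (f n) (f (Suc n))" by (rule conjunct2)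
  qed
  define xs where "xs n = fst (f n)" for n
  define zs where "zs n = fst (snd (f n))" for n
  define ws where "ws n = snd (snd (f n))" for n
  have f_eq: "f n = (xs n, zs n, ws n)" for n by (simp add: xs_def zs_def ws_def)
  have steps: "agree n (xs n) (xs (Suc n))" "agree n (zs n) (zs (Suc n))" "agree n (ws n) (ws (Suc n))" for n
    using f(2)[of n] by (auto simp: f_eq)
  define x where "x i = xs (Suc i) i" for i
  define z where "z i = zs (Suc i) i" for i
  define w where "w i = ws (Suc i) i" for i
  have lim: "agree n (xs n) x" "agree n (zs n) z" "agree n (ws n) w" for n
    unfolding x_def[abs_def] z_def[abs_def] w_def[abs_def] using steps by (intro agree_limit; simp)+
  have lim': "agree n (xs n) a \<Longrightarrow> agree n x a" "agree n (zs n) a \<Longrightarrow> agree n z a"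
    "agree n (ws n) a \<Longrightarrow> agree n w a" for n a
    using lim[of n] by (auto simp: agree_def)
  have "C x z"
  proof (rule ccontr)
    assume "\<not> C x z"
    then obtain n where "\<forall>x' z'. agree n x x' \<longrightarrow> agree n z z' \<longrightarrow> \<not> C x' z'"
      using C(1) unfolding closed_rel_def by blast
    \<comment> \<open>Failure of a closed relation at the limit shows at a finite stage already,
      where one part is empty and hence trivially separated.\<close>
    then have "?P n (xs n) (zs n) = {}"
      by (auto dest!: lim')
    then have "borel_separated (?P n (xs n) (zs n)) (?Q n (xs n) (ws n))"
      unfolding borel_separated_def by (intro bexI[of _ "{}"]) auto
    then show False using f(1)[of n] by (simp add: f_eq)
  qed
  moreover have "C' x w"
  proof (rule ccontr)
    assume "\<not> C' x w"
    then obtain n where "\<forall>x' z'. agree n x x' \<longrightarrow> agree n w z' \<longrightarrow> \<not> C' x' z'"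
      using C'(1) unfolding closed_rel_def by blast
    then have "?Q n (xs n) (ws n) = {}"
      by (auto dest!: lim')
    then have "borel_separated (?P n (xs n) (zs n)) (?Q n (xs n) (ws n))"
      unfolding borel_separated_def by (intro bexI[of _ UNIV]) (auto intro: sets.top[of baire_space, simplified])
    then show False using f(1)[of n] by (simp add: f_eq)
  qed
  ultimately show False using assms(3) C(2) C'(2) by blast
qed


section \<open>Pairs of sequences as single sequences, and projections\<close>

definition evens :: "baire \<Rightarrow> baire" where "evens w = (\<lambda>i. w (2 * i))"
definition odds :: "baire \<Rightarrow> baire" where "odds w = (\<lambda>i. w (2 * i + 1))"
definition interleave :: "baire \<Rightarrow> baire \<Rightarrow> baire" where
  "interleave x y = (\<lambda>i. if even i then x (i div 2) else y (i div 2))"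

lemma evens_interleave [simp]: "evens (interleave x y) = x"
  by (simp add: evens_def interleave_def)

lemma odds_interleave [simp]: "odds (interleave x y) = y"
  by (simp add: odds_def interleave_def)

lemma measurable_evens [measurable]: "evens \<in> measurable baire_space baire_space"
  by (rule measurable_to_baire) (simp add: evens_def)

lemma measurable_odds [measurable]: "odds \<in> measurable baire_space baire_space"
  by (rule measurable_to_baire) (simp add: odds_def)

lemma cont2_evens: "cont2 (\<lambda>x z. evens z)"
  unfolding evens_def by (rule cont2_reindex_snd)

lemma cont2_odds: "cont2 (\<lambda>x z. odds z)"
  unfolding odds_def by (rule cont2_reindex_snd)

lemma cont2_interleave_evens: "cont2 (\<lambda>x z. interleave x (evens z))"
proof (rule cont2I)
  fix x z :: baire and i
  show "\<exists>m. \<forall>x' z'. agree m x x' \<longrightarrow> agree m z z' \<longrightarrow> interleave x (evens z) i = interleave x' (evens z') i"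
    by (rule exI[of _ "Suc (2 * i)"]) (auto simp: agree_def interleave_def evens_def)
qed

lemma analytic_Borel_section:
  assumes "P \<in> sets (baire_space \<Otimes>\<^sub>M baire_space)"
  obtains C where "closed_rel C" "\<And>x y. (x, y) \<in> P \<longleftrightarrow> (\<exists>z. C (interleave x y) z)"
proof -
  have "{w \<in> space baire_space. (evens w, odds w) \<in> P} \<in> sets baire_space"
    using assms by measurable
  then have "analytic {w. (evens w, odds w) \<in> P}"
    using analytic_Borel by simp
  then obtain C where C: "closed_rel C" "\<And>w. (evens w, odds w) \<in> P \<longleftrightarrow> (\<exists>z. C w z)"
    unfolding analytic_def by blast
  show thesis
    using C(2)[of "interleave _ _"] by (intro that[OF C(1)]) simp
qed

text \<open>The witness for the projection interleaves \<open>v\<close> with a witness for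
  \<open>(x, v) \<in> P\<close>.\<close>

lemma analytic_projection:
  assumes "closed_rel E" "P \<in> sets (baire_space \<Otimes>\<^sub>M baire_space)"
  shows "analytic {x. \<exists>v. E x v \<and> (x, v) \<in> P}"
proof -
  obtain C where C: "closed_rel C" "\<And>x y. (x, y) \<in> P \<longleftrightarrow> (\<exists>z. C (interleave x y) z)"
    using analytic_Borel_section[OF assms(2)] by blast
  have "closed_rel (\<lambda>x u. E x (evens u) \<and> C (interleave x (evens u)) (odds u))"
    by (intro closed_rel_conj closed_rel_comp[OF assms(1)] closed_rel_comp[OF C(1)]
        cont2_fst cont2_evens cont2_odds cont2_interleave_evens)
  then show ?thesis
  proof (rule analyticI)
    fix x
    show "x \<in> {x. \<exists>v. E x v \<and> (x, v) \<in> P} \<longleftrightarrow>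
        (\<exists>u. E x (evens u) \<and> C (interleave x (evens u)) (odds u))"
      unfolding C(2) mem_Collect_eq by (metis evens_interleave odds_interleave)
  qed
qed

section \<open>Cylinders and the perfect set argument\<close>

definition extends :: "nat list \<Rightarrow> baire \<Rightarrow> bool" where
  "extends s v \<longleftrightarrow> (\<forall>i<length s. v i = s ! i)"

lemma extends_map: "extends (map v [0..<n]) v"
  by (simp add: extends_def)

lemma extends_map_iff: "extends (map v [0..<n]) w \<longleftrightarrow> agree n v w"
  by (auto simp: extends_def agree_def)

lemma measurable_extends [measurable]: "Measurable.pred baire_space (extends s)"
  unfolding extends_def by measurable

lemma uncountable_cantor: "uncountable (UNIV :: (nat \<Rightarrow> bool) set)"
  unfolding uncountable_def
proof (safe, simp)
  fix f :: "nat \<Rightarrow> nat \<Rightarrow> bool"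
  assume "range f = UNIV"
  then obtain n where "f n = (\<lambda>i. \<not> f i i)" by (metis UNIV_I image_iff)
  then have "f n n = (\<not> f n n)" by (rule fun_cong)
  then show False by simp
qed

text \<open>
  Any analytic set in the plane is the image of a closed relation \<open>E\<close> under
  \<open>(x, v) \<mapsto> (x, evens v)\<close>.  A list \<open>L\<close> of finite sequences is large (relative to a countable
  family \<open>g\<close> of Borel functions) if over one \<open>x\<close> every cylinder in \<open>L\<close> contains a point
  whose second coordinate is none of the \<open>g n x\<close>.  For a suitable \<open>g\<close> every member of a large list
  can be split into two members with disjoint second coordinates, so that a large list grows into a
  perfect set in a single section.
\<close>

locale closed_section =
  fixes E :: "baire \<Rightarrow> baire \<Rightarrow> bool"
  assumes closed_E: "closed_rel E"
begin

text \<open>The prefix \<open>a\<close> is recorded because different levels may be realised over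
  different base points \<open>x\<close>; growing prefixes force these to converge.\<close>

definition large :: "(nat \<Rightarrow> baire \<Rightarrow> baire) \<Rightarrow> nat list \<Rightarrow> nat list list \<Rightarrow> baire set" where
  "large g a L =
     {x. extends a x \<and> (\<forall>s\<in>set L. \<exists>v. extends s v \<and> E x v \<and> (\<forall>n. evens v \<noteq> g n x))}"

abbreviation borel_family :: "(nat \<Rightarrow> baire \<Rightarrow> baire) \<Rightarrow> bool" where
  "borel_family g \<equiv> (\<forall>n. g n \<in> measurable baire_space baire_space)"

text \<open>There are only countably many pairs \<open>(a, L)\<close>. For each pair that some Borel
  family makes empty, one such family is picked, and all of them are merged into a single
  sequence.\<close>

lemma universal_family:
  obtains g where "borel_family g"
    "\<And>a L g'. borel_family g' \<Longrightarrow> large g' a L = {} \<Longrightarrow> large g a L = {}"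
proof -
  have "\<exists>g. borel_family g \<and>
    ((\<exists>g'. borel_family g' \<and> large g' (fst c) (snd c) = {}) \<longrightarrow> large g (fst c) (snd c) = {})" for c
  proof (cases "\<exists>g'. borel_family g' \<and> large g' (fst c) (snd c) = {}")
    case False
    then show ?thesis by (intro exI[of _ "\<lambda>_ x. x"] conjI) (simp, blast)
  qed blast
  then obtain h where h: "\<And>c. borel_family (h c) \<and>
    ((\<exists>g'. borel_family g' \<and> large g' (fst c) (snd c) = {}) \<longrightarrow> large (h c) (fst c) (snd c) = {})"
    by metis
  define g where "g m = h (from_nat (fst (prod_decode m))) (snd (prod_decode m))" for m
  show thesis
  proof
    show "borel_family g" using h by (auto simp: g_def)
    fix a L g' assume "borel_family g'" "large g' a L = {}"
    then have "large (h (a, L)) a L = {}" using h[of "(a, L)"] by auto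
    moreover have "h (a, L) n = g (prod_encode (to_nat (a, L), n))" for n
      by (simp add: g_def)
    ultimately show "large g a L = {}"
      unfolding large_def by simp blast
  qed
qed

lemma analytic_large_section:
  assumes "borel_family g" "P \<in> sets baire_space"
  shows "analytic {x. \<exists>v. extends s v \<and> E x v \<and> (\<forall>n. evens v \<noteq> g n x) \<and> evens v \<in> P}"
proof -
  have [measurable]: "g n \<in> measurable baire_space baire_space" for n using assms by blast
  note assms(2)[measurable]
  have [measurable]: "Measurable.pred (baire_space \<Otimes>\<^sub>M baire_space) (\<lambda>p. evens (snd p) = g n (fst p))" for n
    by (rule pred_baire_eq) measurable
  let ?P = "{p \<in> space (baire_space \<Otimes>\<^sub>M baire_space). extends s (snd p) \<and>
     (\<forall>n. \<not> evens (snd p) = g n (fst p)) \<and> evens (snd p) \<in> P}"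
  have "?P \<in> sets (baire_space \<Otimes>\<^sub>M baire_space)" by measurable
  from analytic_projection[OF closed_E this]
  show ?thesis by (rule back_subst[of analytic]) (auto simp: space_pair_measure)
qed

lemma analytic_large:
  assumes "borel_family g"
  shows "analytic (large g a L)"
proof (induction L)
  case Nil
  have "{x \<in> space baire_space. extends a x} \<in> sets baire_space" by measurable
  then show ?case by (auto simp: large_def intro: analytic_Borel)
next
  case (Cons s L)
  have "large g a (s # L) = large g a L \<inter>
     {x. \<exists>v. extends s v \<and> E x v \<and> (\<forall>n. evens v \<noteq> g n x) \<and> evens v \<in> UNIV}"
    by (auto simp: large_def)
  moreover have "UNIV \<in> sets baire_space" using sets.top[of baire_space] by simp
  ultimately show ?case
    using analytic_Int[OF Cons analytic_large_section[OF assms, of UNIV s]] by simp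
qed

text \<open>For each \<open>k\<close> the sets \<open>A k u\<close> are pairwise disjoint because
  \<open>D\<close> is single-valued. Separating each one from the union of the others by a Borel set
  decides digit \<open>k\<close> of the value, and the resulting \<open>h\<close> is Borel
  everywhere, also where \<open>D\<close> is undefined.\<close>

lemma analytic_function_graph:
  assumes an: "\<And>k u. analytic {x. \<exists>y. D x y \<and> y k = (u::nat)}"
    and fn: "\<And>x y y'. D x y \<Longrightarrow> D x y' \<Longrightarrow> y = y'"
  obtains h where "h \<in> measurable baire_space baire_space" "\<And>x y. D x y \<Longrightarrow> y = h x"
proof -
  define A where "A k u = {x. \<exists>y. D x y \<and> y k = u}" for k u :: nat
  have sep: "borel_separated (A k u) (\<Union>n. if n = u then {} else A k n)" for k u
  proof (rule analytic_separation)
    have "analytic {}" using analytic_coord[of 0 "{}"] by simp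
    then show "analytic (\<Union>n. if n = u then {} else A k n)"
      using an unfolding A_def by (rule_tac analytic_UN) simp
    show "analytic (A k u)" using an by (simp add: A_def)
    show "A k u \<inter> (\<Union>n. if n = u then {} else A k n) = {}"
    proof (rule ccontr)
      assume "A k u \<inter> (\<Union>n. if n = u then {} else A k n) \<noteq> {}"
      then obtain x n where "x \<in> A k u" "x \<in> A k n" "n \<noteq> u" by (auto split: if_splits)
      then obtain y y' where "D x y" "D x y'" "y k \<noteq> y' k" by (auto simp: A_def)
      then show False using fn[of x y y'] by simp
    qed
  qed
  define B where "B k u = (SOME B. B \<in> sets baire_space \<and> A k u \<subseteq> B \<and>
      (\<Union>n. if n = u then {} else A k n) \<inter> B = {})" for k u
  have B': "B k u \<in> sets baire_space \<and> A k u \<subseteq> B k u \<and>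
      (\<Union>n. if n = u then {} else A k n) \<inter> B k u = {}" for k u
    unfolding B_def by (rule someI_ex) (use sep[of k u] in \<open>simp only: borel_separated_def Bex_def\<close>)
  have B: "B k u \<in> sets baire_space" "A k u \<subseteq> B k u"
    "(\<Union>n. if n = u then {} else A k n) \<inter> B k u = {}" for k u
    by (rule B'[THEN conjunct1], rule B'[THEN conjunct2, THEN conjunct1],
        rule B'[THEN conjunct2, THEN conjunct2])
  note B(1)[measurable]
  define h where "h x k = (LEAST u. x \<in> B k u)" for x k
  show thesis
  proof
    show "h \<in> measurable baire_space baire_space"
      by (rule measurable_to_baire) (unfold h_def, measurable)
    fix x y assume D: "D x y"
    show "y = h x"
    proof
      fix k
      have "x \<in> A k (y k)" using D by (auto simp: A_def)
      then have "x \<in> B k u \<longleftrightarrow> u = y k" for u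
        using B(2)[of k "y k"] B(3)[where k=k and u=u] by (cases "u = y k") (auto split: if_splits)
      then show "y k = h x k" unfolding h_def by (simp add: Least_equality)
    qed
  qed
qed

text \<open>Incompatibility is demanded of the even digits, since these carry the point of the
  section, whereas the odd digits hold a witness.\<close>

definition splits :: "nat list \<Rightarrow> nat list \<Rightarrow> nat list \<Rightarrow> bool" where
  "splits s s1 s2 \<longleftrightarrow>
     length s < length s1 \<and> length s < length s2 \<and>
     take (length s) s1 = s \<and> take (length s) s2 = s \<and>
     (\<forall>v1 v2. extends s1 v1 \<longrightarrow> extends s2 v2 \<longrightarrow> evens v1 \<noteq> evens v2)"

context
  fixes g
  assumes g: "borel_family g"
    and universal: "\<And>a L g'. borel_family g' \<Longrightarrow> large g' a L = {} \<Longrightarrow> large g a L = {}"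
begin

text \<open>If no splitting keeps the list large, then over each \<open>x\<close> of the large set
  the cylinder of \<open>s\<close> holds only one value avoiding all \<open>g n x\<close>. These
  values are covered by one Borel function \<open>h\<close>; adding \<open>h\<close> to the family
  empties the large set, so by universality it was empty before.\<close>

lemma split_one:
  assumes "large g a (s # L) \<noteq> {}"
  shows "\<exists>s1 s2. splits s s1 s2 \<and> large g a (s1 # s2 # L) \<noteq> {}"
proof (rule ccontr)
  assume no: "\<not> ?thesis"
  define D where "D x y \<longleftrightarrow> x \<in> large g a (s # L) \<and>
    (\<exists>v. extends s v \<and> E x v \<and> evens v = y \<and> (\<forall>n. y \<noteq> g n x))" for x y
  have "\<exists>h. h \<in> measurable baire_space baire_space \<and> (\<forall>x y. D x y \<longrightarrow> y = h x)"
  proof (rule analytic_function_graph[of D])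
    fix k u
    have "{y \<in> space baire_space. y k = u} \<in> sets baire_space" by measurable
    then have "analytic (large g a (s # L) \<inter> {x. \<exists>v. extends s v \<and> E x v \<and>
        (\<forall>n. evens v \<noteq> g n x) \<and> evens v \<in> {y. y k = u}})"
      by (intro analytic_Int analytic_large analytic_large_section g) simp
    then show "analytic {x. \<exists>y. D x y \<and> y k = u}"
      by (rule back_subst[of analytic]) (auto simp: D_def)
  next
    fix x y y' assume D: "D x y" "D x y'"
    show "y = y'"
    proof (rule ccontr)
      assume "y \<noteq> y'"
      then obtain k where k: "y k \<noteq> y' k" by blast
      obtain v where v: "extends s v" "E x v" "evens v = y" "\<forall>n. y \<noteq> g n x" using D(1) D_def by blast
      obtain v' where v': "extends s v'" "E x v'" "evens v' = y'" "\<forall>n. y' \<noteq> g n x" using D(2) D_def by blast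
      \<comment> \<open>Properly longer than \<open>s\<close>, and long enough to contain digit
        \<open>2 * k\<close> of both witnesses, which is digit \<open>k\<close> of their even
        parts.\<close>
      define N where "N = Suc (max (length s) (2 * k))"
      have N: "2 * k < N" "length s < N" by (simp_all add: N_def)
      define s1 where "s1 = map v [0..<N]"
      define s2 where "s2 = map v' [0..<N]"
      have "extends s1 w1 \<Longrightarrow> extends s2 w2 \<Longrightarrow> evens w1 \<noteq> evens w2" for w1 w2
      proof -
        assume "extends s1 w1" "extends s2 w2"
        then have "v (2 * k) = w1 (2 * k)" "v' (2 * k) = w2 (2 * k)"
          by (simp_all add: s1_def s2_def extends_map_iff agree_def N)
        then have "evens w1 k = y k" "evens w2 k = y' k"
          using v(3) v'(3) by (auto simp: evens_def)
        then show ?thesis using k by auto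
      qed
      moreover have "take (length s) s1 = s" "take (length s) s2 = s"
        using v(1) v'(1) N(2) by (auto intro!: nth_equalityI simp: s1_def s2_def extends_def)
      ultimately have "splits s s1 s2"
        using N(2) by (simp add: splits_def) (simp add: s1_def s2_def)
      moreover have "x \<in> large g a (s1 # s2 # L)"
        using D v v' by (auto simp: D_def large_def s1_def s2_def intro: extends_map)
      ultimately show False using no by blast
    qed
  qed blast
  then obtain h where h: "h \<in> measurable baire_space baire_space" "\<And>x y. D x y \<Longrightarrow> y = h x" by blast
  have "large (case_nat h g) a (s # L) = {}"
  proof (rule ccontr)
    assume "large (case_nat h g) a (s # L) \<noteq> {}"
    then obtain x where x: "x \<in> large (case_nat h g) a (s # L)" by blast
    have *: "(\<forall>n. w \<noteq> case_nat h g n x) \<longleftrightarrow> w \<noteq> h x \<and> (\<forall>n. w \<noteq> g n x)" for w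
      by (metis nat.case old.nat.exhaust)
    from x obtain v where v: "extends s v" "E x v" "evens v \<noteq> h x" "\<forall>n. evens v \<noteq> g n x"
      unfolding large_def mem_Collect_eq * by auto
    moreover have "x \<in> large g a (s # L)" using x unfolding large_def mem_Collect_eq * by auto
    ultimately have "D x (evens v)" by (auto simp: D_def)
    with h(2) v(3) show False by blast
  qed
  moreover have "borel_family (case_nat h g)" using g h(1) by (auto split: nat.split)
  ultimately have "large g a (s # L) = {}" using universal by blast
  with assms show False ..
qed

lemma large_cong_set: "set L = set L' \<Longrightarrow> large g a L = large g a L'"
  by (simp add: large_def)

text \<open>The members of \<open>L\<close> are split one at a time while the finished ones wait in
  \<open>L'\<close>. The halves come out as two lists, so that the children of member
  \<open>i\<close> sit at positions \<open>i\<close> and \<open>i + length L\<close>.\<close>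

lemma split_all:
  assumes "large g a (L @ L') \<noteq> {}"
  shows "\<exists>L1 L2. length L1 = length L \<and> length L2 = length L \<and>
    (\<forall>i<length L. splits (L ! i) (L1 ! i) (L2 ! i)) \<and> large g a (L1 @ L2 @ L') \<noteq> {}"
  using assms
proof (induction L arbitrary: L')
  case (Cons s L)
  then obtain s1 s2 where s: "splits s s1 s2" "large g a (s1 # s2 # (L @ L')) \<noteq> {}"
    using split_one[of a s "L @ L'"] by auto
  have "large g a (s1 # s2 # (L @ L')) = large g a (L @ (s1 # s2 # L'))"
    by (rule large_cong_set) auto
  with s(2) Cons.IH obtain L1 L2 where L: "length L1 = length L" "length L2 = length L"
    "\<forall>i<length L. splits (L ! i) (L1 ! i) (L2 ! i)" "large g a (L1 @ L2 @ (s1 # s2 # L')) \<noteq> {}"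
    by metis
  have "large g a (L1 @ L2 @ (s1 # s2 # L')) = large g a ((s1 # L1) @ (s2 # L2) @ L')"
    by (rule large_cong_set) auto
  moreover have "\<forall>i<length (s # L). splits ((s # L) ! i) ((s1 # L1) ! i) ((s2 # L2) ! i)"
    using L(3) s(1) by (auto simp: less_Suc_eq_0_disj)
  ultimately show ?case using L by (intro exI[of _ "s1 # L1"] exI[of _ "s2 # L2"]) simp
qed simp

lemma large_base:
  assumes "large g a L \<noteq> {}"
  shows "\<exists>k. large g (a @ [k]) L \<noteq> {}"
proof -
  obtain x where "x \<in> large g a L" using assms by blast
  then have "x \<in> large g (a @ [x (length a)]) L"
    by (auto simp: large_def extends_def nth_append less_Suc_eq)
  then show ?thesis by blast
qed

lemma large_levels:
  assumes "large g [] [[]] \<noteq> {}"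
  obtains a L where
    "\<And>n. large g (a n) (L n) \<noteq> {}"
    "\<And>n. length (a n) = n" "\<And>n. length (L n) = 2 ^ n"
    "\<And>n. take n (a (Suc n)) = a n"
    "\<And>n i. i < 2 ^ n \<Longrightarrow> splits (L n ! i) (L (Suc n) ! i) (L (Suc n) ! (i + 2 ^ n))"
proof -
  let ?P = "\<lambda>n p. large g (fst p) (snd p) \<noteq> {} \<and> length (fst p) = n \<and> length (snd p) = 2 ^ n"
  let ?Q = "\<lambda>n p q. take n (fst q) = fst p \<and>
    (\<forall>i<2 ^ n. splits (snd p ! i) (snd q ! i) (snd q ! (i + 2 ^ n)))"
  have "\<exists>f. \<forall>n. ?P n (f n) \<and> ?Q n (f n) (f (Suc n))"
  proof (rule dependent_nat_choice)
    show "\<exists>p. ?P 0 p" using assms by (intro exI[of _ "([], [[]])"]) simp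
  next
    fix p n assume p: "?P n p"
    obtain a L where aL: "p = (a, L)" by (cases p)
    obtain k where "large g (a @ [k]) (L @ []) \<noteq> {}"
      using large_base[of a L] p aL by auto
    from split_all[OF this] obtain L1 L2 where L: "length L1 = length L" "length L2 = length L"
      "\<forall>i<length L. splits (L ! i) (L1 ! i) (L2 ! i)" "large g (a @ [k]) (L1 @ L2) \<noteq> {}"
      by auto
    have "?P (Suc n) (a @ [k], L1 @ L2) \<and> ?Q n p (a @ [k], L1 @ L2)"
      using L p aL by (auto simp: nth_append)
    then show "\<exists>q. ?P (Suc n) q \<and> ?Q n p q" by blast
  qed
  then obtain f where f: "\<forall>n. ?P n (f n) \<and> ?Q n (f n) (f (Suc n))" by (rule exE)
  show thesis
    by (rule that[of "\<lambda>n. fst (f n)" "\<lambda>n. snd (f n)"]) (use f in auto)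
qed

text \<open>The levels form a binary tree of cylinders, whose branches converge to uncountably many
  witnesses over one base point, with pairwise different even parts.\<close>

lemma uncountable_section:
  assumes "large g [] [[]] \<noteq> {}"
  shows "\<exists>x. uncountable {evens v |v. E x v}"
proof -
  obtain a L where L: "\<And>n. large g (a n) (L n) \<noteq> {}"
    "\<And>n. length (a n) = n" "\<And>n. length (L n) = 2 ^ n"
    "\<And>n. take n (a (Suc n)) = a n"
    "\<And>n i. i < 2 ^ n \<Longrightarrow> splits (L n ! i) (L (Suc n) ! i) (L (Suc n) ! (i + 2 ^ n))"
    using large_levels[OF assms] by metis
  have chain: "extends (s n) (\<lambda>i. s (Suc i) ! i)"
    if take: "\<And>n. take (length (s n)) (s (Suc n)) = s n" and len: "\<And>n. n \<le> length (s n)"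
    for s :: "nat \<Rightarrow> nat list" and n
  proof -
    have *: "i < length (s n) \<Longrightarrow> s (n + k) ! i = s n ! i \<and> i < length (s (n + k))" for n k i
    proof (induction k)
      case (Suc k)
      then show ?case using take[of "n + k"] by (metis add_Suc_right length_take min_less_iff_conj nth_take)
    qed simp
    show ?thesis
      unfolding extends_def
    proof (intro allI impI)
      fix i assume i: "i < length (s n)"
      have "i < length (s (Suc i))" using len[of "Suc i"] by simp
      with i show "s (Suc i) ! i = s n ! i"
        using *[of i n "Suc i - n"] *[of i "Suc i" "n - Suc i"] by (cases "n \<le> Suc i") auto
    qed
  qed
  define x where "x i = a (Suc i) ! i" for i
  have x: "extends (a n) x" for n
    unfolding x_def[abs_def] by (rule chain) (simp_all add: L)
  \<comment> \<open>Position at level \<open>n\<close> of the node on branch \<open>b\<close>: the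
    number with binary digits \<open>b 0\<close>, ..., \<open>b (n - 1)\<close>, to match the
    children \<open>i\<close> and \<open>i + 2 ^ n\<close>.\<close>
  define J where "J b = rec_nat (0::nat) (\<lambda>n j. if b n then j + 2 ^ n else j)" for b :: "nat \<Rightarrow> bool"
  have J_Suc: "J b (Suc n) = (if b n then J b n + 2 ^ n else J b n)" and J_0: "J b 0 = 0" for b n
    by (simp_all add: J_def)
  have J_less: "J b n < 2 ^ n" for b n
  proof (induction n)
    case (Suc n)
    then show ?case by (simp add: J_Suc)
  qed (simp add: J_0)
  define s where "s b n = L n ! J b n" for b n
  have s_step: "length (s b n) < length (s b (Suc n))" "take (length (s b n)) (s b (Suc n)) = s b n" for b n
    using L(5)[OF J_less[of b n]] by (simp_all add: s_def splits_def J_Suc)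
  have s_len: "n \<le> length (s b n)" for b n
  proof (induction n)
    case (Suc n)
    then show ?case using s_step(1)[of b n] by simp
  qed simp
  define v where "v b i = s b (Suc i) ! i" for b i
  have v: "extends (s b n) (v b)" for b n
    unfolding v_def[abs_def] by (rule chain) (simp_all add: s_step s_len)
  \<comment> \<open>Each level is realised only over a point \<open>x'\<close> of its own;
    closedness of \<open>E\<close> transfers the relation to the limit.\<close>
  have "E x (v b)" for b
  proof (rule ccontr)
    assume "\<not> E x (v b)"
    then obtain n where n: "\<forall>x' z'. agree n x x' \<longrightarrow> agree n (v b) z' \<longrightarrow> \<not> E x' z'"
      using closed_E unfolding closed_rel_def by blast
    obtain x' where x': "x' \<in> large g (a n) (L n)" using L(1) by blast
    have "s b n \<in> set (L n)" using J_less[of b n] L(3)[of n] by (simp add: s_def)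
    then obtain v' where "extends (s b n) v'" "E x' v'" using x' by (auto simp: large_def)
    moreover have "agree n (v b) v'"
      using v[of b n] \<open>extends (s b n) v'\<close> s_len[of n b] by (auto simp: extends_def agree_def)
    moreover have "agree n x x'"
      using x[of n] x' L(2)[of n] by (auto simp: extends_def agree_def large_def)
    ultimately show False using n by blast
  qed
  moreover have "inj (\<lambda>b. evens (v b))"
  proof (rule injI)
    fix b b' assume eq: "evens (v b) = evens (v b')"
    show "b = b'"
    proof (rule ccontr)
      assume "b \<noteq> b'"
      then have ex: "\<exists>n. b n \<noteq> b' n" by auto
      define n where "n = (LEAST n. b n \<noteq> b' n)"
      have n: "b n \<noteq> b' n" unfolding n_def using ex by (rule LeastI_ex)
      have before: "b m = b' m" if "m < n" for m using not_less_Least that unfolding n_def by blast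
      have "m \<le> n \<Longrightarrow> J b m = J b' m" for m
        by (induction m) (simp_all add: J_0 J_Suc before)
      then have J: "J b n = J b' n" by simp
      have "\<forall>v1 v2. extends (L (Suc n) ! J b n) v1 \<longrightarrow>
          extends (L (Suc n) ! (J b n + 2 ^ n)) v2 \<longrightarrow> evens v1 \<noteq> evens v2"
        using L(5)[OF J_less[of b n]] by (simp add: splits_def)
      moreover have "extends (L (Suc n) ! J c (Suc n)) (v c)" for c using v[of c "Suc n"] by (simp add: s_def)
      ultimately show False
        using n J eq by (metis J_Suc)
    qed
  qed
  ultimately have "uncountable (range (\<lambda>b. evens (v b)))" "range (\<lambda>b. evens (v b)) \<subseteq> {evens v |v. E x v}"
    using uncountable_cantor by (auto dest: countable_image_inj_on)
  then show ?thesis using countable_subset by blast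
qed

end

lemma countable_sections_cover:
  assumes "\<And>x. countable {evens v |v. E x v}"
  obtains g where "borel_family g" "\<And>x v. E x v \<Longrightarrow> \<exists>n. evens v = g n x"
proof -
  obtain g where g: "borel_family g"
    "\<And>a L g'. borel_family g' \<Longrightarrow> large g' a L = {} \<Longrightarrow> large g a L = {}"
    using universal_family by blast
  have "\<exists>x. uncountable {evens v |v. E x v}" if "large g [] [[]] \<noteq> {}"
    using that by (rule uncountable_section[rotated 2]) (use g in blast)+
  then have "large g [] [[]] = {}" using assms by blast
  then show thesis
    by (intro that[OF g(1)]) (auto simp: large_def extends_def)
qed

end

text \<open>A sequence \<open>v\<close> stores the point of the section in its even digits and the
  witness for \<open>P\<close> in its odd digits, which presents \<open>P\<close> as the image of a
  closed relation.\<close>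

theorem Lusin_Novikov_baire:
  assumes "P \<in> sets (baire_space \<Otimes>\<^sub>M baire_space)" "\<And>x. countable {y. (x, y) \<in> P}"
  obtains g where "\<And>n::nat. g n \<in> measurable baire_space baire_space"
    "\<And>x y. (x, y) \<in> P \<Longrightarrow> \<exists>n. y = g n x"
proof -
  obtain C where C: "closed_rel C" "\<And>x y. (x, y) \<in> P \<longleftrightarrow> (\<exists>z. C (interleave x y) z)"
    using analytic_Borel_section[OF assms(1)] by blast
  interpret closed_section "\<lambda>x v. C (interleave x (evens v)) (odds v)"
    by unfold_locales (intro closed_rel_comp[OF C(1)] cont2_odds cont2_interleave_evens)
  have "{evens v |v. C (interleave x (evens v)) (odds v)} \<subseteq> {y. (x, y) \<in> P}" for x
    using C(2) by blast
  then have "countable {evens v |v. C (interleave x (evens v)) (odds v)}" for x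
    using assms(2) countable_subset by blast
  then obtain g where g: "borel_family g"
    "\<And>x v. C (interleave x (evens v)) (odds v) \<Longrightarrow> \<exists>n. evens v = g n x"
    using countable_sections_cover by blast
  show thesis
  proof
    show "g n \<in> measurable baire_space baire_space" for n using g(1) by blast
    fix x y assume "(x, y) \<in> P"
    then obtain z where "C (interleave x y) z" using C(2) by blast
    then show "\<exists>n. y = g n x" using g(2)[of x "interleave y z"] by simp
  qed
qed

section \<open>Standard Borel spaces\<close>

text \<open>
  A point of a Polish space is coded by the set of the balls \<open>ball (p k) (1 / (n + 1))\<close> containing
  it.  Decoding is a limit of points of the dense sequence \<open>p\<close>, so that it is Borel on all codes.
\<close>

lemma polish_coding:
  assumes "standard_borel_space M" "space M \<noteq> {}"
  obtains h :: "'a \<Rightarrow> baire" and g where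
    "h \<in> measurable M baire_space" "g \<in> measurable baire_space M"
    "\<And>x. x \<in> space M \<Longrightarrow> g (h x) = x"
proof -
  obtain T where T: "completely_metrizable_space T" "separable_space T"
    "space M = topspace T" "sets M = sigma_sets (topspace T) {U. openin T U}"
    using assms(1) unfolding standard_borel_space_def by blast
  obtain X d where X: "Metric_space X d" "Metric_space.mcomplete X d" "T = Metric_space.mtopology X d"
    using T(1) unfolding completely_metrizable_space_def by blast
  interpret Metric_space X d by (rule X(1))
  have T_eq: "T = mtopology" and space_M: "space M = X"
    using X(3) T(3) by simp_all
  have sets_M: "sets M = sigma_sets X {U. openin mtopology U}"
    using T(4) by (simp add: T_eq)
  obtain C where C: "countable C" "C \<subseteq> X" "mtopology closure_of C = X"
    using T(2) unfolding separable_space_def by (auto simp: T_eq)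
  have "C \<noteq> {}" using C(3) assms(2) space_M by auto
  define p where "p = from_nat_into C"
  have p_X: "p k \<in> X" for k
    using C(2) from_nat_into[OF \<open>C \<noteq> {}\<close>] by (auto simp: p_def)
  have dense: "\<exists>k. d x (p k) < r" if "x \<in> X" "0 < r" for x r
  proof -
    have "x \<in> mtopology closure_of C" using that C(3) by simp
    then obtain y where "y \<in> C" "d x y < r"
      using \<open>0 < r\<close> by (auto simp: metric_closure_of)
    then show ?thesis
      using from_nat_into_surj[OF C(1)] by (metis p_def)
  qed
  define \<epsilon> where "\<epsilon> n = inverse (real (Suc n))" for n
  have \<epsilon>_pos: "0 < \<epsilon> n" for n by (simp add: \<epsilon>_def)
  have \<epsilon>_small: "\<exists>n. \<epsilon> n < r" if "0 < r" for r
    using reals_Archimedean[OF that] by (simp add: \<epsilon>_def)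
  have \<epsilon>_mono: "m \<le> n \<Longrightarrow> \<epsilon> n \<le> \<epsilon> m" for m n by (simp add: \<epsilon>_def)
  have open_sets: "openin mtopology U \<Longrightarrow> U \<in> sets M" for U
    by (simp add: sets_M sigma_sets.Basic)
  have measurable_dist [measurable]: "Measurable.pred M (\<lambda>x. d x (p k) < r)" for k r
  proof -
    have "mball (p k) r \<in> sets M" by (rule open_sets) simp
    moreover have "{x \<in> space M. d x (p k) < r} = mball (p k) r"
      using p_X by (auto simp: space_M commute)
    ultimately show ?thesis by (simp add: pred_def)
  qed
  define h where "h x i = (if d x (p (fst (prod_decode i))) < \<epsilon> (snd (prod_decode i)) then 1 else 0::nat)" for x i
  have h_meas: "h \<in> measurable M baire_space"
    by (rule measurable_to_baire) (unfold h_def, measurable)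
  define \<kappa> where "\<kappa> n c = (LEAST k. c (prod_encode (k, n)) = (1::nat))" for n c
  have \<kappa>_meas [measurable]: "\<kappa> n \<in> measurable baire_space (count_space UNIV)" for n
    unfolding \<kappa>_def by measurable
  define q where "q n c = p (\<kappa> n c)" for n c
  define Cau where "Cau c \<longleftrightarrow> (\<forall>e. \<exists>N. \<forall>m\<ge>N. \<forall>n\<ge>N. d (q m c) (q n c) < \<epsilon> e)" for c
  have [measurable]: "(\<lambda>c. d (q m c) (q n c)) \<in> borel_measurable baire_space" for m n
  proof -
    have "(\<lambda>c. d (p i) (p (\<kappa> n c))) \<in> borel_measurable baire_space" for i
      by (rule measurable_compose[OF \<kappa>_meas]) simp
    from measurable_compose_countable[OF this \<kappa>_meas] show ?thesis
      unfolding q_def .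
  qed
  have Cau_meas [measurable]: "Measurable.pred baire_space Cau"
    unfolding Cau_def by measurable
  \<comment> \<open>Codes whose decoded sequence is not Cauchy go to \<open>p 0\<close>, which makes
    \<open>g\<close> total; it stays Borel because \<open>Cau\<close> is Borel.\<close>
  define g where "g c = (if Cau c then SOME l. limitin mtopology (\<lambda>n. q n c) l sequentially else p 0)" for c
  have q_X: "q n c \<in> X" for n c by (simp add: q_def p_X)
  have lim: "limitin mtopology (\<lambda>n. q n c) (g c) sequentially" if "Cau c" for c
  proof -
    have "MCauchy (\<lambda>n. q n c)"
      unfolding MCauchy_def
    proof (intro conjI allI impI)
      show "range (\<lambda>n. q n c) \<subseteq> X" using q_X by auto
      fix r :: real assume "0 < r"
      then obtain e where "\<epsilon> e < r" using \<epsilon>_small by blast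
      then show "\<exists>N. \<forall>n n'. N \<le> n \<longrightarrow> N \<le> n' \<longrightarrow> d (q n c) (q n' c) < r"
        using that unfolding Cau_def by (meson less_trans)
    qed
    then have "\<exists>l. limitin mtopology (\<lambda>n. q n c) l sequentially"
      using X(2) unfolding mcomplete_def by blast
    then show ?thesis using that unfolding g_def by (auto intro: someI_ex)
  qed
  have g_X: "g c \<in> X" for c
    using lim[of c] p_X by (cases "Cau c") (auto simp: limitin_metric g_def)
  \<comment> \<open>The distances from \<open>g c\<close> to the dense points are pointwise limits
    of Borel functions, and preimages of open sets will be countable unions of conditions on these
    distances.\<close>
  have lim_dist: "(\<lambda>n. if Cau c then d (q n c) (p k) else d (p 0) (p k)) \<longlonglongrightarrow> d (g c) (p k)" for c k
  proof (cases "Cau c")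
    case True
    then have dist_0: "(\<lambda>n. d (q n c) (g c)) \<longlonglongrightarrow> 0"
      using lim by (simp add: limitin_metric_dist_null)
    have "\<bar>d (q n c) (p k) - d (g c) (p k)\<bar> \<le> d (q n c) (g c)" for n
      using triangle[of "q n c" "g c" "p k"] triangle[of "g c" "q n c" "p k"] commute[of "g c" "q n c"]
        q_X g_X p_X by simp
    then have "\<forall>n. norm (d (q n c) (p k) - d (g c) (p k)) \<le> d (q n c) (g c)" by simp
    with dist_0 have "(\<lambda>n. d (q n c) (p k) - d (g c) (p k)) \<longlonglongrightarrow> 0"
      by (rule Lim_null_comparison[OF always_eventually, rotated])
    then show ?thesis using True by (simp add: LIM_zero_iff)
  next
    case False
    then show ?thesis by (simp add: g_def)
  qed
  have dq: "(\<lambda>c. d (q n c) (p k)) \<in> borel_measurable baire_space" for n k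
    unfolding q_def by (rule measurable_compose[OF \<kappa>_meas]) simp
  have dist_meas: "(\<lambda>c. d (g c) (p k)) \<in> borel_measurable baire_space" for k
    by (rule borel_measurable_LIMSEQ_real[OF lim_dist]) (use dq in measurable)
  have g_meas: "g \<in> measurable baire_space M"
  proof (rule measurable_sigma_sets[OF sets_M])
    show "{U. openin mtopology U} \<subseteq> Pow X" using openin_subset by fastforce
    show "g \<in> space baire_space \<rightarrow> X" using g_X by simp
    fix U assume U: "U \<in> {U. openin mtopology U}"
    let ?good = "\<lambda>k n. mball (p k) (\<epsilon> n) \<subseteq> U"
    have "g c \<in> U \<longleftrightarrow> (\<exists>k n. ?good k n \<and> d (g c) (p k) < \<epsilon> n)" for c
    proof
      assume "g c \<in> U"
      then obtain r where r: "r > 0" "mball (g c) r \<subseteq> U"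
        using U by (auto simp: openin_mtopology)
      obtain n where n: "\<epsilon> n < r / 2" using \<epsilon>_small[of "r / 2"] r by auto
      obtain k where k: "d (g c) (p k) < \<epsilon> n" using dense[OF g_X \<epsilon>_pos] by blast
      have "mball (p k) (\<epsilon> n) \<subseteq> mball (g c) r"
      proof
        fix y assume y: "y \<in> mball (p k) (\<epsilon> n)"
        then have "d (g c) y \<le> d (g c) (p k) + d (p k) y"
          using triangle[of "g c" "p k" y] g_X p_X by simp
        then show "y \<in> mball (g c) r" using y n k g_X by simp
      qed
      then show "\<exists>k n. ?good k n \<and> d (g c) (p k) < \<epsilon> n" using r(2) k by blast
    next
      assume "\<exists>k n. ?good k n \<and> d (g c) (p k) < \<epsilon> n"
      then obtain k n where "?good k n" "d (g c) (p k) < \<epsilon> n" by blast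
      then show "g c \<in> U" using p_X g_X commute[of "g c" "p k"] by (auto simp: subset_iff)
    qed
    then have "g -` U \<inter> space baire_space =
        {c \<in> space baire_space. \<exists>k n. ?good k n \<and> d (g c) (p k) < \<epsilon> n}" by auto
    also have "\<dots> \<in> sets baire_space" using dist_meas by measurable
    finally show "g -` U \<inter> space baire_space \<in> sets baire_space" .
  qed
  have "g (h x) = x" if "x \<in> space M" for x
  proof -
    have x: "x \<in> X" using that space_M by simp
    have close: "d x (q n (h x)) < \<epsilon> n" for n
    proof -
      have *: "h x (prod_encode (k, n)) = 1 \<longleftrightarrow> d x (p k) < \<epsilon> n" for k by (simp add: h_def)
      have "\<exists>k. h x (prod_encode (k, n)) = 1" unfolding * using dense[OF x \<epsilon>_pos] .
      then have "h x (prod_encode (\<kappa> n (h x), n)) = 1" unfolding \<kappa>_def by (rule LeastI_ex)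
      then show ?thesis unfolding * q_def .
    qed
    have "Cau (h x)"
      unfolding Cau_def
    proof
      fix e
      obtain N where N: "\<epsilon> N < \<epsilon> e / 2" using \<epsilon>_small[of "\<epsilon> e / 2"] \<epsilon>_pos by auto
      have "d (q m (h x)) (q n (h x)) < \<epsilon> e" if "m \<ge> N" "n \<ge> N" for m n
        using triangle[of "q m (h x)" x "q n (h x)"] x q_X close[of m] close[of n]
          \<epsilon>_mono[OF that(1)] \<epsilon>_mono[OF that(2)] N commute[of x "q m (h x)"] by simp
      then show "\<exists>N. \<forall>m\<ge>N. \<forall>n\<ge>N. d (q m (h x)) (q n (h x)) < \<epsilon> e" by blast
    qed
    then have "limitin mtopology (\<lambda>n. q n (h x)) (g (h x)) sequentially" by (rule lim)
    moreover have "limitin mtopology (\<lambda>n. q n (h x)) x sequentially"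
      unfolding limitin_metric
    proof (intro conjI allI impI x)
      fix r :: real assume "r > 0"
      then obtain N where "\<epsilon> N < r" using \<epsilon>_small by blast
      then have "d (q n (h x)) x < r" if "n \<ge> N" for n
        using close[of n] \<epsilon>_mono[OF that] commute[of x "q n (h x)"] by simp
      then show "\<forall>\<^sub>F n in sequentially. q n (h x) \<in> X \<and> d (q n (h x)) x < r"
        using q_X by (auto simp: eventually_sequentially)
    qed
    ultimately show ?thesis
      by (metis limitin_metric_unique trivial_limit_sequentially)
  qed
  with h_meas g_meas show thesis by (rule that)
qed

text \<open>The relation is transported to Baire space along the coding, and the functions found
  there are decoded again.\<close>

theorem countable_borel_equiv_enumeration:
  assumes M: "standard_borel_space M"
    and R: "borel_equiv_on M (space M) R" "countable_classes (space M) R"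
  obtains f :: "nat \<Rightarrow> 'a \<Rightarrow> 'a" where
    "\<And>n. f n \<in> measurable M M" "\<And>x. f 0 x = x"
    "\<And>x y. x \<in> space M \<Longrightarrow> (x, y) \<in> R \<longleftrightarrow> (\<exists>n. y = f n x)"
proof (cases "space M = {}")
  case True
  show thesis by (rule that[of "\<lambda>n x. x"]) (simp_all add: True)
next
  case False
  have equiv: "equiv (space M) R" and R_meas [measurable]: "R \<in> sets (M \<Otimes>\<^sub>M M)"
    using R(1) by (auto simp: borel_equiv_on_def)
  obtain h g where h [measurable]: "h \<in> measurable M baire_space"
    and g [measurable]: "g \<in> measurable baire_space M"
    and gh: "\<And>x. x \<in> space M \<Longrightarrow> g (h x) = x"
    using polish_coding[OF M False] by blast
  have [measurable]: "Measurable.pred baire_space (\<lambda>c. h (g c) = c)"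
    by (rule pred_baire_eq) measurable
  define P where "P = {z \<in> space (baire_space \<Otimes>\<^sub>M baire_space).
    h (g (snd z)) = snd z \<and> (g (fst z), g (snd z)) \<in> R}"
  have "P \<in> sets (baire_space \<Otimes>\<^sub>M baire_space)"
    unfolding P_def by measurable
  moreover have "countable {y. (x, y) \<in> P}" for x
  proof -
    have "g x \<in> space M" using measurable_space[OF g] by simp
    then have "countable (h ` (R `` {g x}))"
      using R(2) unfolding countable_classes_def by blast
    moreover have "{y. (x, y) \<in> P} \<subseteq> h ` (R `` {g x})"
      by (auto simp: P_def intro!: image_eqI[where f=h])
    ultimately show ?thesis by (rule countable_subset[rotated])
  qed
  ultimately obtain G where G [measurable]: "\<And>n::nat. G n \<in> measurable baire_space baire_space"
    and cover: "\<And>x y. (x, y) \<in> P \<Longrightarrow> \<exists>n. y = G n x"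
    using Lusin_Novikov_baire by metis
  \<comment> \<open>Index 0 is reserved for the identity. A candidate outside the class is replaced
    by \<open>x\<close>, so that every graph stays inside \<open>R\<close>.\<close>
  define f where "f n x = (case n of 0 \<Rightarrow> x | Suc m \<Rightarrow>
    (if (x, g (G m (h x))) \<in> R then g (G m (h x)) else x))" for n x
  show thesis
  proof
    show "f n \<in> measurable M M" for n
    proof (cases n)
      case 0
      then show ?thesis by (simp add: f_def[abs_def])
    next
      case (Suc m)
      then show ?thesis by (simp add: f_def[abs_def])
    qed
    show "f 0 x = x" for x by (simp add: f_def)
    fix x y assume x: "x \<in> space M"
    then have xx: "(x, x) \<in> R" using equiv by (meson equiv_def refl_onD)
    show "(x, y) \<in> R \<longleftrightarrow> (\<exists>n. y = f n x)"
    proof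
      assume xy: "(x, y) \<in> R"
      then have y: "y \<in> space M" using equiv by (auto simp: equiv_def refl_on_def)
      have "(h x, h y) \<in> P" using xy x y by (simp add: P_def gh space_pair_measure)
      then obtain n where "h y = G n (h x)" using cover by blast
      then have "y = g (G n (h x))" using gh[OF y] by simp
      with xy have "y = f (Suc n) x" by (simp add: f_def)
      then show "\<exists>n. y = f n x" ..
    next
      assume "\<exists>n. y = f n x"
      then obtain n where "y = f n x" ..
      then show "(x, y) \<in> R" using xx by (cases n) (auto simp: f_def split: if_splits)
    qed
  qed
qed

lemma standard_borel_diagonal:
  assumes "standard_borel_space M"
  shows "Measurable.pred (M \<Otimes>\<^sub>M M) (\<lambda>z. fst z = snd z)"
proof (cases "space M = {}")
  case True
  then show ?thesis by (simp add: pred_def space_pair_measure)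
next
  case False
  obtain h g where h [measurable]: "h \<in> measurable M baire_space"
    and gh: "\<And>x. x \<in> space M \<Longrightarrow> g (h x) = x"
    using polish_coding[OF assms False] by metis
  have "Measurable.pred (M \<Otimes>\<^sub>M M) (\<lambda>z. h (fst z) = h (snd z))"
    by (rule pred_baire_eq) measurable
  moreover have "h (fst z) = h (snd z) \<longleftrightarrow> fst z = snd z" if "z \<in> space (M \<Otimes>\<^sub>M M)" for z
    using that gh by (metis mem_Times_iff space_pair_measure)
  ultimately show ?thesis by (simp cong: measurable_cong)
qed

lemma pred_standard_borel_eq:
  assumes "standard_borel_space M" "f \<in> measurable N M" "g \<in> measurable N M"
  shows "Measurable.pred N (\<lambda>x. f x = g x)"
  using measurable_compose[OF measurable_Pair[OF assms(2,3)] standard_borel_diagonal[OF assms(1)]]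
  by simp

section \<open>Free families of relations\<close>

text \<open>The index argument is that of the last step, which the next step has to avoid. Steps
  with equal ends are excluded, so the relations enter without their extension by equality.\<close>

inductive reduced_walk :: "'j set \<Rightarrow> ('j \<Rightarrow> 'a rel) \<Rightarrow> 'a \<Rightarrow> 'j \<Rightarrow> 'a \<Rightarrow> bool"
  for J Q where
  single: "j \<in> J \<Longrightarrow> (x, y) \<in> Q j \<Longrightarrow> x \<noteq> y \<Longrightarrow> reduced_walk J Q x j y"
| step: "reduced_walk J Q x j y \<Longrightarrow> k \<in> J \<Longrightarrow> k \<noteq> j \<Longrightarrow> (y, z) \<in> Q k \<Longrightarrow> y \<noteq> z \<Longrightarrow>
    reduced_walk J Q x k z"

definition free_family :: "'j set \<Rightarrow> ('j \<Rightarrow> 'a rel) \<Rightarrow> bool" where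
  "free_family J Q \<longleftrightarrow> (\<forall>x j y. reduced_walk J Q x j y \<longrightarrow> x \<noteq> y)"

lemma reduced_walk_mono:
  assumes "reduced_walk J Q x j y" "J \<subseteq> J'" "\<And>j. j \<in> J \<Longrightarrow> Q j \<subseteq> Q' j"
  shows "reduced_walk J' Q' x j y"
  using assms(1)
proof induction
  case (single j x y)
  then show ?case using assms(2,3) by (blast intro: reduced_walk.single)
next
  case (step x j y k z)
  then show ?case using assms(2,3) by (blast intro: reduced_walk.step)
qed

lemma free_family_mono:
  "free_family J' Q' \<Longrightarrow> J \<subseteq> J' \<Longrightarrow> (\<And>j. j \<in> J \<Longrightarrow> Q j \<subseteq> Q' j) \<Longrightarrow> free_family J Q"
  unfolding free_family_def using reduced_walk_mono by metis

lemma reduced_walk_index: "reduced_walk J Q x j y \<Longrightarrow> j \<in> J"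
  by (induction rule: reduced_walk.induct)

text \<open>Two successive steps with the same index merge by transitivity; a merged step that is
  trivial is dropped, leaving the walk before it.\<close>

lemma walk_reduce:
  assumes trans: "\<And>j. j \<in> J \<Longrightarrow> trans (Q j)"
    and "(x, y) \<in> (\<Union>j\<in>J. Q j)\<^sup>*"
  shows "x = y \<or> (\<exists>j. reduced_walk J Q x j y)"
  using assms(2)
proof (induction rule: rtrancl_induct)
  case (step y z)
  from step(2) obtain k where k: "k \<in> J" "(y, z) \<in> Q k" by blast
  show ?case
  proof (cases "y = z")
    case True
    then show ?thesis using step.IH by simp
  next
    case False
    from step.IH show ?thesis
    proof
      assume "x = y"
      then show ?thesis using k False by (blast intro: reduced_walk.single)
    next
      assume "\<exists>j. reduced_walk J Q x j y"
      then obtain j where j: "reduced_walk J Q x j y" ..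
      show ?thesis
      proof (cases "k = j")
        case neq: False
        then show ?thesis using j k False by (blast intro: reduced_walk.step)
      next
        case True
        from j show ?thesis
        proof cases
          case single
          then have "(x, z) \<in> Q k" using k True trans by (meson transD)
          then show ?thesis using k by (blast intro: reduced_walk.single)
        next
          case (step j' w)
          then have "(w, z) \<in> Q k" using k True trans by (meson transD)
          then show ?thesis using step True k by (cases "w = z") (blast intro: reduced_walk.step)+
        qed
      qed
    qed
  qed
qed simp

section \<open>Refining, regrouping and contracting free families\<close>

lemma reduced_walk_append:
  assumes "reduced_walk J' Q y k z" "reduced_walk J Q x j y" "J' \<subseteq> J" "j \<notin> J'"
  shows "reduced_walk J Q x k z"
  using assms
proof induction
  case (single k y z)
  then show ?case by (metis reduced_walk.step subsetD)
next
  case (step y k z k' z')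
  then show ?case by (metis reduced_walk.step subsetD)
qed

text \<open>A walk in the refined family is cut into maximal blocks with the same \<open>i\<close>.
  Each block is reduced in \<open>Q i\<close>, hence has distinct ends, so the blocks form a reduced
  walk in \<open>R\<close>.\<close>

lemma free_family_refine:
  assumes free: "free_family I R" and trans: "\<And>i. i \<in> I \<Longrightarrow> trans (R i)"
    and sub: "\<And>i j. i \<in> I \<Longrightarrow> j \<in> J i \<Longrightarrow> Q i j \<subseteq> R i"
    and free_i: "\<And>i. i \<in> I \<Longrightarrow> free_family (J i) (Q i)"
  shows "free_family (Sigma I J) (\<lambda>(i, j). Q i j)"
proof -
  \<comment> \<open>Here \<open>z\<close> is the start of the current block, reached by a reduced
    walk in \<open>R\<close> that ended with another index.\<close>
  have walk: "\<exists>z. (z = x \<or> (\<exists>i'. i' \<noteq> fst p \<and> reduced_walk I R x i' z)) \<and>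
      reduced_walk (J (fst p)) (Q (fst p)) z (snd p) y \<and> (z, y) \<in> R (fst p)"
    if "reduced_walk (Sigma I J) (\<lambda>(i, j). Q i j) x p y" for x p y
    using that
  proof induction
    case (single p x y)
    then show ?case
      using sub[of "fst p" "snd p"] by (auto intro!: exI[of _ x] reduced_walk.single)
  next
    case (step x p y p' y')
    obtain i j where p: "p = (i, j)" by (cases p)
    obtain i' j' where p': "p' = (i', j')" by (cases p')
    have i: "i \<in> I" using reduced_walk_index[OF step.hyps(1)] p by simp
    have i': "i' \<in> I" "j' \<in> J i'" "(y, y') \<in> Q i' j'" using step.hyps p' by auto
    obtain z where z: "z = x \<or> (\<exists>i'. i' \<noteq> i \<and> reduced_walk I R x i' z)"
      "reduced_walk (J i) (Q i) z j y" "(z, y) \<in> R i"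
      using step.IH p by auto
    show ?case
    proof (cases "i = i'")
      case True
      have "reduced_walk (J i) (Q i) z j' y'"
        using z(2) i' True step.hyps p p' by (auto intro: reduced_walk.step)
      moreover have "(z, y') \<in> R i"
        using z(3) i' True sub trans by (meson subsetD transD)
      ultimately show ?thesis using z(1) True p' by auto
    next
      case False
      have "z \<noteq> y" using free_i[OF i] z(2) unfolding free_family_def by blast
      then have "reduced_walk I R x i y"
        using z(1,3) i by (auto intro: reduced_walk.intros)
      moreover have "reduced_walk (J i') (Q i') y j' y'"
        using i' step.hyps by (auto intro: reduced_walk.single)
      moreover have "(y, y') \<in> R i'" using i' sub by blast
      ultimately show ?thesis using False p' by auto
    qed
  qed
  show ?thesis
    unfolding free_family_def
  proof (intro allI impI)
    fix x p y assume w: "reduced_walk (Sigma I J) (\<lambda>(i, j). Q i j) x p y"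
    have i: "fst p \<in> I" using reduced_walk_index[OF w] by auto
    obtain z where z: "z = x \<or> (\<exists>i'. i' \<noteq> fst p \<and> reduced_walk I R x i' z)"
      "reduced_walk (J (fst p)) (Q (fst p)) z (snd p) y" "(z, y) \<in> R (fst p)"
      using walk[OF w] by blast
    have "z \<noteq> y" using free_i[OF i] z(2) unfolding free_family_def by blast
    then have "reduced_walk I R x (fst p) y"
      using z(1,3) i by (auto intro: reduced_walk.intros)
    then show "x \<noteq> y" using free unfolding free_family_def by blast
  qed
qed

text \<open>Each step of a grouped relation expands into a reduced walk with indices in one fibre of
  \<open>\<pi>\<close>. Fibres are disjoint, so concatenated expansions stay reduced.\<close>

lemma free_family_regroup:
  assumes free: "free_family J Q" and trans: "\<And>j. j \<in> J \<Longrightarrow> trans (Q j)"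
    and gen: "\<And>k. k \<in> K \<Longrightarrow> Q' k \<subseteq> (\<Union>j\<in>{j \<in> J. \<pi> j = k}. Q j)\<^sup>*"
  shows "free_family K Q'"
proof -
  have red: "\<exists>j. reduced_walk {j \<in> J. \<pi> j = k} Q y j z" if "k \<in> K" "(y, z) \<in> Q' k" "y \<noteq> z" for k y z
  proof -
    have "(y, z) \<in> (\<Union>j\<in>{j \<in> J. \<pi> j = k}. Q j)\<^sup>*" using gen that by blast
    from walk_reduce[OF _ this] show ?thesis using trans that(3) by blast
  qed
  have "\<exists>j. reduced_walk J Q x j y \<and> \<pi> j = k" if "reduced_walk K Q' x k y" for x k y
    using that
  proof induction
    case (single k x y)
    then obtain j where j: "reduced_walk {j \<in> J. \<pi> j = k} Q x j y" using red by blast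
    from reduced_walk_mono[OF j] have "reduced_walk J Q x j y" by blast
    then show ?case using reduced_walk_index[OF j] by blast
  next
    case (step x k y k' z)
    then obtain j where j: "reduced_walk J Q x j y" "\<pi> j = k" by blast
    obtain j' where j': "reduced_walk {j \<in> J. \<pi> j = k'} Q y j' z" using step red by blast
    have "reduced_walk J Q x j' z"
      by (rule reduced_walk_append[OF j' j(1)]) (use j(2) step.hyps in auto)
    then show ?case using reduced_walk_index[OF j'] by blast
  qed
  then show ?thesis using free unfolding free_family_def by blast
qed

text \<open>
  Collapsing the classes of \<open>F = {(x, y). r x = r y}\<close>: a walk in the images lifts to a walk in
  the original relations in which the jumps between lifts of the same point are steps of \<open>F\<close>.
\<close>

lemma free_family_contract:
  assumes free: "free_family (insert None (Some ` J)) (case_option F Q)"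
    and sub: "\<And>j. j \<in> J \<Longrightarrow> Q j \<subseteq> X \<times> X"
    and F: "\<And>x y. x \<in> X \<Longrightarrow> y \<in> X \<Longrightarrow> r x = r y \<Longrightarrow> (x, y) \<in> F"
  shows "free_family J (\<lambda>j. map_prod r r ` Q j)"
proof -
  let ?W = "reduced_walk (insert None (Some ` J)) (case_option F Q)"
  have lift: "\<exists>x y. x \<in> X \<and> y \<in> X \<and> r x = a \<and> r y = b \<and> ?W x (Some j) y"
    if "reduced_walk J (\<lambda>j. map_prod r r ` Q j) a j b" for a j b
    using that
  proof induction
    case (single j a b)
    then obtain x y where xy: "(x, y) \<in> Q j" "a = r x" "b = r y" by auto
    have "?W x (Some j) y" by (rule reduced_walk.single) (use single xy in auto)
    moreover have "x \<in> X" "y \<in> X" using xy(1) sub[OF single(1)] by auto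
    ultimately show ?case using xy(2,3) by metis
  next
    case (step a j b k c)
    then obtain x y where xy: "x \<in> X" "y \<in> X" "r x = a" "r y = b" "?W x (Some j) y" by blast
    obtain u w where uw: "(u, w) \<in> Q k" "b = r u" "c = r w" using step.hyps by auto
    have X: "u \<in> X" "w \<in> X" using uw sub step.hyps by blast+
    have ne: "u \<noteq> w" using uw step.hyps by auto
    have "?W x (Some k) w"
    proof (cases "y = u")
      case True
      show ?thesis by (rule reduced_walk.step[OF xy(5)]) (use True step.hyps(2,3) uw(1) ne in simp_all)
    next
      case False
      have yu: "(y, u) \<in> F" using F[OF xy(2) X(1)] xy(4) uw(2) by simp
      have "?W x None u"
        by (rule reduced_walk.step[OF xy(5)]) (use False yu in simp_all)
      then show ?thesis by (rule reduced_walk.step) (use step.hyps(2) uw(1) ne in simp_all)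
    qed
    then show ?case using xy(1,3) uw(3) X(2) by metis
  qed
  show ?thesis
    unfolding free_family_def
  proof (intro allI impI notI)
    fix a j b assume w: "reduced_walk J (\<lambda>j. map_prod r r ` Q j) a j b" and "a = b"
    then obtain x y where xy: "x \<in> X" "y \<in> X" "r x = r y" "?W x (Some j) y"
      using lift[OF w] by auto
    then have "x \<noteq> y" using free unfolding free_family_def by blast
    \<comment> \<open>A closed walk below lifts to a walk between points with the same image, and a
      last step in \<open>F\<close> closes it.\<close>
    have "?W x None x"
      by (rule reduced_walk.step[OF xy(4)]) (use F[OF xy(2,1)] xy(3) \<open>x \<noteq> y\<close> in simp_all)
    then show False using free unfolding free_family_def by blast
  qed
qed

text \<open>An edge is encoded as the equivalence relation that it generates on its two ends, so
  that edges can be factors of a free product.\<close>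

definition edge_rel :: "'a \<Rightarrow> 'a \<Rightarrow> 'a rel" where
  "edge_rel x y = {x, y} \<times> {x, y}"

lemma trans_edge_rel: "trans (edge_rel x y)"
  by (auto simp: edge_rel_def trans_def)

text \<open>A reduced walk descends along \<open>\<rho>\<close>, possibly crosses one piece, and then climbs for ever.\<close>

lemma free_family_pieces_forest:
  fixes rank :: "'a \<Rightarrow> nat"
  assumes rank: "\<And>x. x \<in> Z \<Longrightarrow> rank (\<rho> x) < rank x"
    and S_Z: "\<And>k a b. k \<in> K \<Longrightarrow> (a, b) \<in> S k \<Longrightarrow> a \<notin> Z \<and> b \<notin> Z"
    and S_disj: "\<And>k k' a b c. k \<in> K \<Longrightarrow> k' \<in> K \<Longrightarrow> (a, b) \<in> S k \<Longrightarrow> (b, c) \<in> S k' \<Longrightarrow> k = k'"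
  shows "free_family (Inl ` K \<union> Inr ` Z) (case_sum S (\<lambda>x. edge_rel x (\<rho> x)))"
proof -
  define P where "P = {(u, \<rho> u) |u. u \<in> Z}"
  have P_I: "u \<in> Z \<Longrightarrow> (u, \<rho> u) \<in> P" for u by (auto simp: P_def)
  have P_rank: "rank y \<le> rank x" if "(x, y) \<in> P\<^sup>*" for x y
    using that by induction (auto simp: P_def dest: rank intro: less_imp_le order_trans)
  have P_rank_less: "rank y \<le> rank (\<rho> x) \<and> x \<in> Z" if "(x, y) \<in> P\<^sup>*" "x \<noteq> y" for x y
  proof -
    from that obtain w where "(x, w) \<in> P" "(w, y) \<in> P\<^sup>*" by (metis converse_rtranclE)
    then show ?thesis using P_rank by (auto simp: P_def)
  qed
  have "single_valued P" by (auto simp: P_def single_valued_def)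
  then have comparable: "(u, v) \<in> P\<^sup>* \<or> (v, u) \<in> P\<^sup>*" if "(x, u) \<in> P\<^sup>*" "(x, v) \<in> P\<^sup>*" for x u v
    using single_valued_confluent that by metis
  \<comment> \<open>The descent from \<open>x\<close> has passed through only one child of
    \<open>\<rho> u\<close>, so climbing back through another child \<open>v\<close> leaves that
    path.\<close>
  have no_child: "(x, v) \<notin> P\<^sup>*" if "(x, u) \<in> P\<^sup>*" "u \<in> Z" "v \<in> Z" "\<rho> v = \<rho> u" "u \<noteq> v" for x u v
  proof
    assume "(x, v) \<in> P\<^sup>*"
    then have "(u, v) \<in> P\<^sup>* \<or> (v, u) \<in> P\<^sup>*" using that(1) comparable by blast
    then have "rank v \<le> rank (\<rho> u) \<or> rank u \<le> rank (\<rho> v)" using P_rank_less that(5) by blast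
    then show False using rank[OF that(2)] rank[OF that(3)] that(4) by auto
  qed
  have end_unique: "u = y" if "(x, u) \<in> P\<^sup>*" "(x, y) \<in> P\<^sup>*" "u \<notin> Z" "y \<notin> Z" for x u y
    using comparable[OF that(1,2)] P_rank_less that(3,4) by blast
  let ?Q = "case_sum S (\<lambda>x. edge_rel x (\<rho> x))"
  let ?J = "Inl ` K \<union> Inr ` Z"
  \<comment> \<open>Three phases: descending; just across a piece; climbing, where the last edge
    belongs to \<open>y\<close> and \<open>y\<close> is off the descent from \<open>x\<close>. In
    the last phase \<open>y \<in> Z\<close> rules out a piece, and the edge of \<open>y\<close>
    cannot be used twice in a row, so the walk keeps climbing.\<close>
  have walk: "(\<exists>u. (x, u) \<in> P\<^sup>* \<and> u \<in> Z \<and> j = Inr u \<and> y = \<rho> u) \<or>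
      (\<exists>k u. k \<in> K \<and> j = Inl k \<and> (x, u) \<in> P\<^sup>* \<and> u \<notin> Z \<and> (u, y) \<in> S k \<and> u \<noteq> y) \<or>
      (j = Inr y \<and> y \<in> Z \<and> (x, y) \<notin> P\<^sup>*)" (is "?I x j y")
    if "reduced_walk ?J ?Q x j y" for x j y
    using that
  proof induction
    case (single j x y)
    show ?case
    proof (cases j)
      case (Inl k)
      then have "k \<in> K" "(x, y) \<in> S k" using single by auto
      then show ?thesis using single(3) Inl S_Z by blast
    next
      case (Inr v)
      then have v: "v \<in> Z" "(x = v \<and> y = \<rho> v) \<or> (x = \<rho> v \<and> y = v)"
        using single by (auto simp: edge_rel_def)
      from v(2) show ?thesis
      proof
        assume "x = \<rho> v \<and> y = v"
        then have "(x, y) \<notin> P\<^sup>*" using P_rank[of x y] rank[OF v(1)] by auto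
        then show ?thesis using Inr v \<open>x = \<rho> v \<and> y = v\<close> by blast
      qed (use Inr v in blast)
    qed
  next
    case (step x j y k z)
    show ?case
    proof (cases k)
      case (Inl k')
      then have k': "k' \<in> K" "(y, z) \<in> S k'" using step.hyps by auto
      then have y: "y \<notin> Z" using S_Z by blast
      from step.IH consider u where "(x, u) \<in> P\<^sup>*" "u \<in> Z" "y = \<rho> u"
        | k'' u where "k'' \<in> K" "j = Inl k''" "(u, y) \<in> S k''"
        | "y \<in> Z" by blast
      then show ?thesis
      proof cases
        case 1
        then have "(x, y) \<in> P\<^sup>*" using P_I by (auto intro: rtrancl_into_rtrancl)
        then show ?thesis using k' y Inl step.hyps by blast
      next
        case 2
        then show ?thesis using S_disj[OF 2(1) k'(1) 2(3) k'(2)] Inl step.hyps by blast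
      qed (use y in blast)
    next
      case (Inr v)
      then have v: "v \<in> Z" "(y = v \<and> z = \<rho> v) \<or> (y = \<rho> v \<and> z = v)"
        using step.hyps by (auto simp: edge_rel_def)
      from v(2) show ?thesis
      proof
        assume yz: "y = v \<and> z = \<rho> v"
        from step.IH consider u where "(x, u) \<in> P\<^sup>*" "u \<in> Z" "y = \<rho> u"
          | k'' u where "k'' \<in> K" "(u, y) \<in> S k''"
          | "j = Inr y" by blast
        then show ?thesis
        proof cases
          case 1
          then have "(x, y) \<in> P\<^sup>*" using P_I by (auto intro: rtrancl_into_rtrancl)
          then have "(x, y) \<in> P\<^sup>* \<and> y \<in> Z \<and> k = Inr y \<and> z = \<rho> y" using Inr v(1) yz by simp
          then show ?thesis by blast
        next
          case 2
          then show ?thesis using S_Z[OF 2] v(1) yz by simp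
        qed (use Inr yz step.hyps in blast)
      next
        assume yz: "y = \<rho> v \<and> z = v"
        have down: "(x, y) \<in> P\<^sup>*" if "(x, v) \<in> P\<^sup>*"
          using that P_I[OF v(1)] yz by (auto intro: rtrancl_into_rtrancl)
        have "(x, v) \<notin> P\<^sup>*"
        proof
          assume xv: "(x, v) \<in> P\<^sup>*"
          from step.IH consider u where "(x, u) \<in> P\<^sup>*" "u \<in> Z" "j = Inr u" "y = \<rho> u"
            | k'' u where "k'' \<in> K" "(x, u) \<in> P\<^sup>*" "u \<notin> Z" "(u, y) \<in> S k''" "u \<noteq> y"
            | "(x, y) \<notin> P\<^sup>*" by blast
          then show False
          proof cases
            case 1
            then have "u \<noteq> v" using Inr step.hyps by blast
            then show False using no_child[OF 1(1,2) v(1)] 1(4) yz xv by metis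
          next
            case 2
            then have "y \<notin> Z" using S_Z by blast
            then show False using end_unique[OF 2(2) down[OF xv] 2(3)] 2(5) by blast
          qed (use down[OF xv] in blast)
        qed
        then show ?thesis using Inr v yz by blast
      qed
    qed
  qed
  show ?thesis
    unfolding free_family_def
  proof (intro allI impI notI)
    fix x j y assume w: "reduced_walk ?J ?Q x j y" and eq: "x = y"
    from walk[OF w] consider u where "(x, u) \<in> P\<^sup>*" "u \<in> Z" "y = \<rho> u"
      | k u where "k \<in> K" "(x, u) \<in> P\<^sup>*" "u \<notin> Z" "(u, y) \<in> S k" "u \<noteq> y"
      | "(x, y) \<notin> P\<^sup>*" by blast
    then show False
    proof cases
      case 1
      then show ?thesis using P_rank[OF 1(1)] rank[OF 1(2)] eq by simp
    next
      case 2
      then have "y \<notin> Z" using S_Z by blast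
      then show ?thesis using end_unique[OF 2(2) _ 2(3)] eq 2(5) by blast
    qed (use eq in simp)
  qed
qed

section \<open>Free families versus the definition of free products\<close>

lemma reduced_walk_sequence:
  assumes "reduced_walk J Q a i b"
  shows "\<exists>(n::nat) x j. n \<ge> 2 \<and> x 1 = a \<and> x n = b \<and> j (n - 1) = i \<and>
     (\<forall>k\<in>{1..n-1}. j k \<in> J \<and> (x k, x (k + 1)) \<in> Q (j k) \<and> x k \<noteq> x (k + 1)) \<and>
     (\<forall>k\<in>{1..n-2}. j k \<noteq> j (k + 1))"
  using assms
proof induction
  case (single i a b)
  show ?case
    by (rule exI[of _ 2], rule exI[of _ "\<lambda>k. if k = 1 then a else b"], rule exI[of _ "\<lambda>_. i"])
      (use single in simp)
next
  case (step a i b i' c)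
  then obtain n :: nat and x j where h: "n \<ge> 2" "x 1 = a" "x n = b" "j (n - 1) = i"
    "\<forall>k\<in>{1..n-1}. j k \<in> J \<and> (x k, x (k + 1)) \<in> Q (j k) \<and> x k \<noteq> x (k + 1)"
    "\<forall>k\<in>{1..n-2}. j k \<noteq> j (k + 1)" by blast
  let ?x = "x(Suc n := c)" and ?j = "j(n := i')"
  have "?j k \<in> J \<and> (?x k, ?x (k + 1)) \<in> Q (?j k) \<and> ?x k \<noteq> ?x (k + 1)" if "k \<in> {1..Suc n - 1}" for k
  proof (cases "k = n")
    case True
    then show ?thesis using step.hyps h(3) by simp
  next
    case False
    then have "k \<in> {1..n-1}" using that by auto
    then show ?thesis using h(5) False that by auto
  qed
  moreover have "?j k \<noteq> ?j (k + 1)" if "k \<in> {1..Suc n - 2}" for k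
  proof (cases "k = n - 1")
    case True
    then show ?thesis using h(1,4) step.hyps by auto
  next
    case False
    then have "k \<in> {1..n-2}" using that by auto
    then show ?thesis using h(6) False that by auto
  qed
  moreover have "Suc n \<ge> 2" "?x 1 = a" "?x (Suc n) = c" "?j (Suc n - 1) = i'" using h by auto
  ultimately show ?case by blast
qed

lemma free_family_of_countable_free_product:
  assumes "countable_free_product Y J Q E"
  shows "free_family J Q"
  unfolding free_family_def
proof (intro allI impI notI)
  fix a i b assume "reduced_walk J Q a i b" "a = b"
  from reduced_walk_sequence[OF this(1)] obtain n :: nat and x j where h: "n \<ge> 2" "x 1 = a" "x n = b"
    "\<forall>k\<in>{1..n-1}. j k \<in> J \<and> (x k, x (k + 1)) \<in> Q (j k) \<and> x k \<noteq> x (k + 1)"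
    "\<forall>k\<in>{1..n-2}. j k \<noteq> j (k + 1)" by blast
  have "n \<ge> 2 \<and> x n = x 1 \<and>
      (\<forall>k\<in>{1..n-1}. j k \<in> J \<and> (x k, x (k + 1)) \<in> extend_rel Y (Q (j k))) \<and>
      (\<forall>k\<in>{1..n-2}. j k \<noteq> j (k + 1))"
    using h \<open>a = b\<close> by (auto simp: extend_rel_def)
  then have "\<exists>k\<in>{1..n-1}. x k = x (k + 1)"
    using assms unfolding countable_free_product_def by blast
  then show False using h(4) by blast
qed

text \<open>Reachability inside \<open>Y\<close> is an equivalence relation containing all the
  factors, so minimality of \<open>E\<close> applies.\<close>

lemma countable_free_product_generates:
  assumes "countable_free_product Y J Q E" "\<And>j. j \<in> J \<Longrightarrow> Q j \<subseteq> Y \<times> Y" "\<And>j. j \<in> J \<Longrightarrow> sym (Q j)"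
  shows "E \<subseteq> (\<Union>j\<in>J. Q j)\<^sup>*"
proof -
  let ?F = "(\<Union>j\<in>J. Q j)\<^sup>* \<inter> Y \<times> Y"
  have "sym ((\<Union>j\<in>J. Q j)\<^sup>*)" using assms(3) by (intro sym_rtrancl) (auto simp: sym_def)
  then have "equiv Y ?F"
    by (auto simp: equiv_def refl_on_def sym_def trans_def)
  moreover have "\<forall>j\<in>J. extend_rel Y (Q j) \<subseteq> ?F"
    using assms(2) by (auto simp: extend_rel_def)
  ultimately have "E \<subseteq> ?F"
    using assms(1) unfolding countable_free_product_def generated_equiv_def by blast
  then show ?thesis by blast
qed

lemma countable_free_productI:
  fixes Y :: "'a set"
  assumes "countable J" "free_family J Q" "equiv Y E"
    and sub: "\<And>j. j \<in> J \<Longrightarrow> Q j \<subseteq> E"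
    and gen: "E \<subseteq> (\<Union>j\<in>J. Q j)\<^sup>*"
  shows "countable_free_product Y J Q E"
  unfolding countable_free_product_def
proof (intro conjI allI impI assms(1))
  show "generated_equiv Y J (\<lambda>j. extend_rel Y (Q j)) E"
    unfolding generated_equiv_def
  proof (intro conjI ballI allI impI assms(3))
    show "extend_rel Y (Q j) \<subseteq> E" if "j \<in> J" for j
      using sub[OF that] assms(3) by (auto simp: extend_rel_def equiv_def refl_on_def)
    fix F assume F: "equiv Y F \<and> (\<forall>j\<in>J. extend_rel Y (Q j) \<subseteq> F)"
    have "(x, y) \<in> F" if "(x, y) \<in> (\<Union>j\<in>J. Q j)\<^sup>*" "x \<in> Y" for x y
      using that
    proof (induction rule: rtrancl_induct)
      case base
      then show ?case using F by (meson equiv_def refl_onD)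
    next
      case (step y z)
      then have "(y, z) \<in> F" using F by (auto simp: extend_rel_def)
      then show ?case using step F by (meson equiv_def transD)
    qed
    moreover have "E \<subseteq> Y \<times> Y" using assms(3) by (auto simp: equiv_def refl_on_def)
    ultimately show "E \<subseteq> F" using gen by auto
  qed
next
  fix n :: nat and x :: "nat \<Rightarrow> 'a" and j
  assume h: "n \<ge> 2 \<and> x n = x 1 \<and>
      (\<forall>k\<in>{1..n-1}. j k \<in> J \<and> (x k, x (k + 1)) \<in> extend_rel Y (Q (j k))) \<and>
      (\<forall>k\<in>{1..n-2}. j k \<noteq> j (k + 1))"
  show "\<exists>k\<in>{1..n-1}. x k = x (k + 1)"
  proof (rule ccontr)
    assume "\<not> ?thesis"
    then have ne: "x k \<noteq> x (k + 1)" if "k \<in> {1..n-1}" for k using that by blast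
    have steps: "j k \<in> J" "(x k, x (k + 1)) \<in> Q (j k)" "x k \<noteq> x (k + 1)" if "k \<in> {1..n-1}" for k
    proof -
      have "j k \<in> J \<and> (x k, x (k + 1)) \<in> extend_rel Y (Q (j k))" using h that by blast
      then show "j k \<in> J" "(x k, x (k + 1)) \<in> Q (j k)" "x k \<noteq> x (k + 1)"
        using ne[OF that] by (auto simp: extend_rel_def)
    qed
    have "reduced_walk J Q (x 1) (j (Suc m)) (x (Suc m + 1))" if "Suc m \<le> n - 1" for m
      using that
    proof (induction m)
      case 0
      then show ?case using steps[of 1] by (auto intro: reduced_walk.single)
    next
      case (Suc m)
      have "Suc m \<in> {1..n-2}" using Suc.prems by auto
      then have "j (Suc m) \<noteq> j (Suc m + 1)" using h by blast
      moreover have "reduced_walk J Q (x 1) (j (Suc m)) (x (Suc m + 1))" using Suc by simp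
      ultimately show ?case
        using steps[of "Suc (Suc m)"] Suc.prems by (auto intro: reduced_walk.step)
    qed
    from this[of "n - 2"] have "reduced_walk J Q (x 1) (j (Suc (n - 2))) (x n)"
      using h by (simp add: Suc_diff_Suc numeral_2_eq_2)
    then show False using assms(2) h unfolding free_family_def by metis
  qed
qed

text \<open>An edge has only two ends, so consecutive edges of a cycle through distinct vertices
  carry different indices, and the cycle would be a closed reduced walk.\<close>

lemma acyclic_graph_of_free_edges:
  assumes free: "free_family E (\<lambda>e. edge_rel (s e) (t e))"
    and G: "\<And>a b. (a, b) \<in> G \<Longrightarrow> a \<noteq> b \<and> (\<exists>e\<in>E. (a, b) \<in> edge_rel (s e) (t e))"
  shows "acyclic_graph G"
  unfolding acyclic_graph_def
proof
  assume "\<exists>xs. 3 \<le> length xs \<and> distinct xs \<and>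
      (\<forall>m. m + 1 < length xs \<longrightarrow> (xs ! m, xs ! (m + 1)) \<in> G) \<and> (last xs, hd xs) \<in> G"
  then obtain xs where xs: "3 \<le> length xs" "distinct xs"
    "\<And>m. m + 1 < length xs \<Longrightarrow> (xs ! m, xs ! (m + 1)) \<in> G" "(last xs, hd xs) \<in> G" by blast
  let ?Q = "\<lambda>e. edge_rel (s e) (t e)"
  have diff: "e \<noteq> e'" if "(a, b) \<in> ?Q e" "(b, c) \<in> ?Q e'" "a \<noteq> b" "b \<noteq> c" "a \<noteq> c" for a b c e e'
    using that by (auto simp: edge_rel_def)
  have walk: "\<exists>e. reduced_walk E ?Q (xs ! 0) e (xs ! Suc m) \<and> (xs ! m, xs ! Suc m) \<in> ?Q e"
    if "Suc m < length xs" for m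
    using that
  proof (induction m)
    case 0
    then show ?case using G[OF xs(3)[of 0]] by (auto intro: reduced_walk.single)
  next
    case (Suc m)
    then obtain e where e: "reduced_walk E ?Q (xs ! 0) e (xs ! Suc m)" "(xs ! m, xs ! Suc m) \<in> ?Q e"
      by auto
    obtain e' where e': "e' \<in> E" "(xs ! Suc m, xs ! Suc (Suc m)) \<in> ?Q e'" "xs ! Suc m \<noteq> xs ! Suc (Suc m)"
      using G[OF xs(3)[of "Suc m"]] Suc.prems by auto
    have "e \<noteq> e'"
      by (rule diff[OF e(2) e'(2)]) (use xs(2) Suc.prems in \<open>simp_all add: nth_eq_iff_index_eq\<close>)
    then show ?case using e e' by (blast intro: reduced_walk.step)
  qed
  let ?n = "length xs"
  obtain e where e: "reduced_walk E ?Q (xs ! 0) e (xs ! (?n - 1))" "(xs ! (?n - 2), xs ! (?n - 1)) \<in> ?Q e"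
  proof -
    have "Suc (?n - 2) = ?n - 1" "?n - 1 < ?n" using xs(1) by auto
    then show ?thesis using walk[of "?n - 2"] that by auto
  qed
  have ends: "last xs = xs ! (?n - 1)" "hd xs = xs ! 0"
    using xs(1) by (cases xs; simp add: last_conv_nth)+
  obtain e' where e': "e' \<in> E" "(xs ! (?n - 1), xs ! 0) \<in> ?Q e'" "xs ! (?n - 1) \<noteq> xs ! 0"
    using G[OF xs(4)] unfolding ends by blast
  \<comment> \<open>The closing edge changes index too: vertices \<open>?n - 2\<close>,
    \<open>?n - 1\<close> and \<open>0\<close> are distinct because the cycle has length at least
    3.\<close>
  have "e \<noteq> e'"
  proof (rule diff[OF e(2) e'(2)])
    have "?n - 2 < ?n" "?n - 1 < ?n" "0 < ?n" using xs(1) by auto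
    then show "xs ! (?n - 2) \<noteq> xs ! (?n - 1)" "xs ! (?n - 1) \<noteq> xs ! 0" "xs ! (?n - 2) \<noteq> xs ! 0"
      using xs(1,2) by (simp_all add: nth_eq_iff_index_eq)
  qed
  then have "reduced_walk E ?Q (xs ! 0) e' (xs ! 0)"
    using e e' by (blast intro: reduced_walk.step)
  then show False using free unfolding free_family_def by blast
qed

section \<open>Collapsing a forest onto A\<close>

text \<open>
  \<open>par x\<close> is the parent of \<open>x\<close>, reached inside its \<open>Q (cl x)\<close>-class; \<open>rk\<close> is any rank making
  parents well-founded, \<open>r\<close> the root map, and \<open>q i\<close> attaches the points of \<open>D i\<close> to the pieces \<open>Y i k\<close>.
\<close>

locale kurosh_data =
  fixes I :: "'i set" and Q :: "'i \<Rightarrow> 'a rel" and X A :: "'a set"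
    and par :: "'a \<Rightarrow> 'a" and cl :: "'a \<Rightarrow> 'i" and rk :: "'a \<Rightarrow> nat" and r :: "'a \<Rightarrow> 'a"
    and D :: "'i \<Rightarrow> 'a set" and Y :: "'i \<Rightarrow> nat \<Rightarrow> 'a set" and q :: "'i \<Rightarrow> 'a \<Rightarrow> 'a"
  assumes free_Q: "free_family I Q"
    and sym_Q: "i \<in> I \<Longrightarrow> sym (Q i)" and trans_Q: "i \<in> I \<Longrightarrow> trans (Q i)"
    and Q_sub: "i \<in> I \<Longrightarrow> Q i \<subseteq> X \<times> X"
    and A_sub: "A \<subseteq> X"
    and par: "x \<in> X \<Longrightarrow> x \<notin> A \<Longrightarrow> cl x \<in> I \<and> (x, par x) \<in> Q (cl x) \<and> rk (par x) < rk x"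
    and r_A: "x \<in> A \<Longrightarrow> r x = x"
    and r_par: "x \<in> X \<Longrightarrow> x \<notin> A \<Longrightarrow> r x = r (par x)"
    and D_eq: "i \<in> I \<Longrightarrow> D i = {x. (x, x) \<in> Q i \<and> (x \<in> A \<or> cl x \<noteq> i)}"
    and Y_sub: "i \<in> I \<Longrightarrow> Y i k \<subseteq> D i"
    and Y_class: "i \<in> I \<Longrightarrow> (y, y') \<in> Q i \<Longrightarrow> y \<in> Y i k \<Longrightarrow> y' \<in> Y i k' \<Longrightarrow> k = k'"
    and Y_inj: "i \<in> I \<Longrightarrow> inj_on r (Y i k)"
    and q: "i \<in> I \<Longrightarrow> x \<in> D i \<Longrightarrow> x \<notin> (\<Union>k. Y i k) \<Longrightarrow> (x, q i x) \<in> Q i \<and> q i x \<in> (\<Union>k. Y i k)"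
begin

definition Z :: "'i \<Rightarrow> 'a set" where "Z i = {x. (x, x) \<in> Q i \<and> x \<notin> (\<Union>k. Y i k)}"

text \<open>Every point outside the pieces owns one forest edge: points of \<open>D i\<close> jump
  into a piece, the others go to their parent in the same class.\<close>

definition \<rho> :: "'i \<Rightarrow> 'a \<Rightarrow> 'a" where "\<rho> i x = (if x \<in> D i then q i x else par x)"

definition S :: "'i \<Rightarrow> nat \<Rightarrow> 'a rel" where "S i k = Q i \<inter> Y i k \<times> Y i k"

definition factor :: "'i \<times> (nat + 'a) \<Rightarrow> 'a rel" where
  "factor = (\<lambda>(i, c). case_sum (S i) (\<lambda>x. edge_rel x (\<rho> i x)) c)"

definition indices :: "('i \<times> (nat + 'a)) set" where
  "indices = Sigma I (\<lambda>i. Inl ` UNIV \<union> Inr ` Z i)"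

text \<open>Only the attaching edges survive the collapse, since the two ends of a parent edge have
  the same root; \<open>a \<noteq> b\<close> removes those that became loops.\<close>

definition edges :: "'a rel" where
  "edges = {(a, b). a \<noteq> b \<and> (\<exists>i\<in>I. \<exists>x\<in>D i - (\<Union>k. Y i k). (a, b) \<in> edge_rel (r x) (r (q i x)))}"

lemma par_X: "x \<in> X \<Longrightarrow> x \<notin> A \<Longrightarrow> par x \<in> X"
  using par Q_sub by blast

lemma r_in_A: "x \<in> X \<Longrightarrow> r x \<in> A"
proof (induction "rk x" arbitrary: x rule: less_induct)
  case less
  then show ?case
    by (cases "x \<in> A") (simp_all add: r_A r_par par par_X)
qed

lemma Q_refl: "i \<in> I \<Longrightarrow> (x, y) \<in> Q i \<Longrightarrow> (x, x) \<in> Q i \<and> (y, y) \<in> Q i"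
  using sym_Q trans_Q by (meson symD transD)

lemma not_D:
  assumes "i \<in> I" "(x, x) \<in> Q i" "x \<notin> D i"
  shows "x \<in> X" "x \<notin> A" "cl x = i" "(x, par x) \<in> Q i" "rk (par x) < rk x"
proof -
  show 1: "x \<in> X" using assms Q_sub by blast
  show 2: "x \<notin> A" and 3: "cl x = i" using assms D_eq by auto
  show "(x, par x) \<in> Q i" "rk (par x) < rk x" using par[OF 1 2] 3 by auto
qed

lemma rho_Q: "i \<in> I \<Longrightarrow> x \<in> Z i \<Longrightarrow> (x, \<rho> i x) \<in> Q i"
  using q not_D by (auto simp: Z_def \<rho>_def)

lemma factor_sub:
  assumes "p \<in> indices"
  shows "factor p \<subseteq> Q (fst p)"
proof -
  obtain i c where p: "p = (i, c)" "i \<in> I" using assms by (auto simp: indices_def)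
  show ?thesis
  proof (cases c)
    case (Inr x)
    then have "(x, \<rho> i x) \<in> Q i" using rho_Q p assms by (auto simp: indices_def)
    then show ?thesis
      using p Inr Q_refl[OF p(2)] sym_Q[OF p(2)] by (auto simp: factor_def edge_rel_def dest: symD)
  qed (use p in \<open>auto simp: factor_def S_def\<close>)
qed

lemma trans_factor: "p \<in> indices \<Longrightarrow> trans (factor p)"
  using trans_Q by (auto simp: indices_def factor_def trans_edge_rel S_def intro!: trans_Int)
    (auto simp: trans_def)

text \<open>For each \<open>i\<close> the pieces and the forest edges form a free family by
  \<open>free_family_pieces_forest\<close>, and \<open>free_family_refine\<close> substitutes it for
  \<open>Q i\<close>.\<close>

lemma free_factors: "free_family indices factor"
  unfolding indices_def factor_def
proof (rule free_family_refine[OF free_Q trans_Q])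
  fix i assume i: "i \<in> I"
  show "case_sum (S i) (\<lambda>x. edge_rel x (\<rho> i x)) c \<subseteq> Q i" if "c \<in> Inl ` UNIV \<union> Inr ` Z i" for c
    using factor_sub[of "(i, c)"] i that by (simp add: indices_def factor_def)
  \<comment> \<open>A parent may land in \<open>D i\<close>, where ranks are 0 or 1; a point with a
    parent has \<open>rk x > 0\<close>, so \<open>Suc (rk x)\<close> exceeds both.\<close>
  define rank where "rank x = (if x \<in> (\<Union>k. Y i k) then 0 else if x \<in> D i then 1 else Suc (rk x))" for x
  show "free_family (Inl ` UNIV \<union> Inr ` Z i) (case_sum (S i) (\<lambda>x. edge_rel x (\<rho> i x)))"
  proof (rule free_family_pieces_forest)
    fix x assume x: "x \<in> Z i"
    show "rank (\<rho> i x) < rank x"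
    proof (cases "x \<in> D i")
      case True
      then show ?thesis using x q[OF i True] by (auto simp: rank_def \<rho>_def Z_def)
    next
      case False
      then have "rk (par x) < rk x" using not_D i x by (auto simp: Z_def)
      then show ?thesis using x False by (auto simp: rank_def \<rho>_def Z_def)
    qed
  next
    show "a \<notin> Z i \<and> b \<notin> Z i" if "(a, b) \<in> S i k" for k a b
      using that by (auto simp: S_def Z_def)
    show "k = k'" if "(a, b) \<in> S i k" "(b, c) \<in> S i k'" for k k' a b c
      using that Y_class[OF i, of b b k k'] Q_refl[OF i, of b c] by (auto simp: S_def)
  qed
qed

text \<open>The factors that remain after the collapse; the indices left out are those of the parent
  edges.\<close>

definition level_indices :: "('i \<times> (nat + 'a)) set" where
  "level_indices = {(i, c) \<in> indices. \<forall>x. c = Inr x \<longrightarrow> x \<in> D i}"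

text \<open>The parent edges of all \<open>i\<close> are regrouped into the single factor
  \<open>?F\<close>, the kernel of \<open>r\<close> on \<open>X\<close>, which
  \<open>free_family_contract\<close> then collapses.\<close>

lemma free_level: "free_family level_indices (\<lambda>p. map_prod r r ` factor p)"
proof (rule free_family_contract)
  let ?F = "{(x, y). x \<in> X \<and> y \<in> X \<and> r x = r y}"
  show "x \<in> X \<Longrightarrow> y \<in> X \<Longrightarrow> r x = r y \<Longrightarrow> (x, y) \<in> ?F" for x y by simp
  show "factor p \<subseteq> X \<times> X" if "p \<in> level_indices" for p
  proof -
    have p: "p \<in> indices" using that by (auto simp: level_indices_def)
    then have "fst p \<in> I" by (auto simp: indices_def)
    then show ?thesis using factor_sub[OF p] Q_sub by blast
  qed
  let ?\<pi> = "\<lambda>(i, c). case c of Inl k \<Rightarrow> Some (i, c) | Inr x \<Rightarrow> if x \<in> D i then Some (i, c) else None"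
  show "free_family (insert None (Some ` level_indices)) (case_option ?F factor)"
  proof (rule free_family_regroup[OF free_factors trans_factor])
    fix k assume k: "k \<in> insert None (Some ` level_indices)"
    show "case_option ?F factor k \<subseteq> (\<Union>j\<in>{j \<in> indices. ?\<pi> j = k}. factor j)\<^sup>*"
    proof (cases k)
      case (Some p)
      then have p: "p \<in> indices" "?\<pi> p = k"
        using k by (auto simp: level_indices_def split: sum.split)
      then have "factor p \<subseteq> (\<Union>j\<in>{j \<in> indices. ?\<pi> j = k}. factor j)" by blast
      then show ?thesis using Some by (auto intro: r_into_rtrancl)
    next
      case None
      let ?H = "\<Union>j\<in>{j \<in> indices. ?\<pi> j = k}. factor j"
      \<comment> \<open>Parent edges join each point to its root. The edge of \<open>x\<close> has
        index \<open>(cl x, Inr x)\<close>, which falls into the group \<open>None\<close> because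
        \<open>x \<notin> D (cl x)\<close>.\<close>
      have to_root: "(x, r x) \<in> ?H\<^sup>* \<and> (r x, x) \<in> ?H\<^sup>*" if "x \<in> X" for x
        using that
      proof (induction "rk x" arbitrary: x rule: less_induct)
        case less
        show ?case
        proof (cases "x \<in> A")
          case True
          then show ?thesis by (simp add: r_A)
        next
          case False
          note px = par[OF less.prems False]
          have xx: "(x, x) \<in> Q (cl x)" using px Q_refl by blast
          have nD: "x \<notin> D (cl x)" using px False D_eq by auto
          then have "x \<notin> Y (cl x) k" for k using px Y_sub by blast
          then have "(cl x, Inr x) \<in> indices" using px xx by (auto simp: indices_def Z_def)
          moreover have "?\<pi> (cl x, Inr x) = k" using nD None by simp
          moreover have "(x, par x) \<in> factor (cl x, Inr x)" "(par x, x) \<in> factor (cl x, Inr x)"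
            using nD by (auto simp: factor_def \<rho>_def edge_rel_def)
          ultimately have H: "(x, par x) \<in> ?H" "(par x, x) \<in> ?H" by blast+
          have "(par x, r (par x)) \<in> ?H\<^sup>* \<and> (r (par x), par x) \<in> ?H\<^sup>*"
            using less.hyps[of "par x"] px par_X[OF less.prems False] by blast
          then show ?thesis
            using H r_par[OF less.prems False] by (auto intro: converse_rtrancl_into_rtrancl rtrancl_into_rtrancl)
        qed
      qed
      have "(x, y) \<in> ?H\<^sup>*" if "x \<in> X" "y \<in> X" "r x = r y" for x y
      proof (rule rtrancl_trans)
        show "(x, r x) \<in> ?H\<^sup>*" using to_root[OF that(1)] ..
        show "(r x, y) \<in> ?H\<^sup>*" unfolding that(3) using to_root[OF that(2)] ..
      qed
      then show ?thesis using None by auto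
    qed
  qed
qed

lemma map_prod_edge_rel: "map_prod r r ` edge_rel x y = edge_rel (r x) (r y)"
  by (auto simp: edge_rel_def)

text \<open>The image of a transitive relation need not be transitive; injectivity of
  \<open>r\<close> on \<open>Y i k\<close> lets two steps be composed before taking the
  image.\<close>

lemma trans_map_prod_factor:
  assumes "p \<in> level_indices"
  shows "trans (map_prod r r ` factor p)"
proof -
  have p': "p \<in> indices" using assms by (auto simp: level_indices_def)
  obtain i c where p: "p = (i, c)" "i \<in> I" using p' by (auto simp: indices_def)
  show ?thesis
  proof (cases c)
    case (Inl k)
    show ?thesis
    proof (rule transI)
      fix u v w
      assume "(u, v) \<in> map_prod r r ` factor p" "(v, w) \<in> map_prod r r ` factor p"
      then obtain a b b' c where *: "(a, b) \<in> S i k" "(b', c) \<in> S i k" "u = r a" "v = r b" "v = r b'" "w = r c"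
        using Inl p by (auto simp: factor_def)
      then have "b = b'" using Y_inj[OF p(2), of k] by (auto simp: S_def dest: inj_onD)
      then have "(a, c) \<in> S i k" using *(1,2) trans_Q[OF p(2)] by (auto simp: S_def dest: transD)
      then show "(u, w) \<in> map_prod r r ` factor p" using * Inl p by (auto simp: factor_def)
    qed
  qed (use p in \<open>simp add: factor_def map_prod_edge_rel trans_edge_rel\<close>)
qed

lemma edge_index:
  "i \<in> I \<Longrightarrow> x \<in> D i - (\<Union>k. Y i k) \<Longrightarrow> (i, Inr x) \<in> level_indices"
  "x \<in> D i \<Longrightarrow> map_prod r r ` factor (i, Inr x) = edge_rel (r x) (r (q i x))"
  using D_eq by (auto simp: level_indices_def indices_def Z_def factor_def \<rho>_def map_prod_edge_rel)

lemma acyclic_edges: "acyclic_graph edges"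
proof (rule acyclic_graph_of_free_edges)
  let ?E = "{p \<in> level_indices. \<exists>x. snd p = Inr x}"
  let ?s = "\<lambda>p. r (projr (snd p))" and ?t = "\<lambda>p. r (q (fst p) (projr (snd p)))"
  show "free_family ?E (\<lambda>p. edge_rel (?s p) (?t p))"
  proof (rule free_family_mono[OF free_level])
    fix p assume p: "p \<in> ?E"
    then obtain i x where ix: "p = (i, Inr x)" by (cases p) auto
    then have "x \<in> D i" using p by (auto simp: level_indices_def)
    then show "edge_rel (?s p) (?t p) \<subseteq> map_prod r r ` factor p"
      using edge_index(2) ix by simp
  qed auto
  fix a b assume "(a, b) \<in> edges"
  then obtain i x where "a \<noteq> b" "i \<in> I" "x \<in> D i - (\<Union>k. Y i k)" "(a, b) \<in> edge_rel (r x) (r (q i x))"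
    by (auto simp: edges_def)
  then show "a \<noteq> b \<and> (\<exists>p\<in>?E. (a, b) \<in> edge_rel (?s p) (?t p))"
    using edge_index(1) by (intro conjI bexI[of _ "(i, Inr x)"]) auto
qed

text \<open>All attaching edges are regrouped under the index \<open>None\<close>, where their
  closure contains \<open>T\<close>; each piece keeps an index of its own.\<close>

lemma free_kurosh_family:
  assumes "T \<subseteq> edges\<^sup>*"
  shows "free_family (kurosh_index I K) (kurosh_family (\<lambda>i k. map_prod r r ` S i k) T)"
proof (rule free_family_regroup[OF free_level trans_map_prod_factor])
  let ?\<pi> = "\<lambda>(i, c). case c of Inl k \<Rightarrow> Some (i, k) | Inr x \<Rightarrow> None"
  let ?Q = "\<lambda>p. map_prod r r ` factor p"
  fix j assume j: "j \<in> kurosh_index I K"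
  show "kurosh_family (\<lambda>i k. map_prod r r ` S i k) T j \<subseteq> (\<Union>p\<in>{p \<in> level_indices. ?\<pi> p = j}. ?Q p)\<^sup>*"
  proof (cases j)
    case None
    have "edges \<subseteq> (\<Union>p\<in>{p \<in> level_indices. ?\<pi> p = j}. ?Q p)"
    proof
      fix e assume "e \<in> edges"
      then obtain i x where "i \<in> I" "x \<in> D i - (\<Union>k. Y i k)" "e \<in> edge_rel (r x) (r (q i x))"
        by (auto simp: edges_def)
      then show "e \<in> (\<Union>p\<in>{p \<in> level_indices. ?\<pi> p = j}. ?Q p)"
        using edge_index None by (intro UN_I[of "(i, Inr x)"]) auto
    qed
    then have "edges\<^sup>* \<subseteq> (\<Union>p\<in>{p \<in> level_indices. ?\<pi> p = j}. ?Q p)\<^sup>*" by (rule rtrancl_mono)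
    then show ?thesis using assms None by (auto simp: kurosh_family_def)
  next
    case (Some ik)
    obtain i k where ik: "ik = (i, k)" by (cases ik)
    then have "(i, Inl k) \<in> level_indices" using j Some
      by (auto simp: kurosh_index_def level_indices_def indices_def)
    then have "?Q (i, Inl k) \<subseteq> (\<Union>p\<in>{p \<in> level_indices. ?\<pi> p = j}. ?Q p)"
      using Some ik by (intro UN_upper) simp
    moreover have "kurosh_family (\<lambda>i k. map_prod r r ` S i k) T j = ?Q (i, Inl k)"
      using Some ik by (simp add: kurosh_family_def factor_def)
    ultimately show ?thesis by (metis (no_types, lifting) r_into_rtrancl subrelI subset_iff)
  qed
qed

lemma edges_sub: "edges \<subseteq> A \<times> A"
proof -
  have "r x \<in> A \<and> r (q i x) \<in> A" if "i \<in> I" "x \<in> D i - (\<Union>k. Y i k)" for i x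
    using that q[of i x] Q_sub[of i] by (blast intro: r_in_A)
  then show ?thesis by (auto simp: edges_def edge_rel_def)
qed

lemma sym_edges: "sym edges"
  by (auto simp: edges_def sym_def edge_rel_def)

lemma irrefl_edges: "irrefl edges"
  by (simp add: edges_def irrefl_def)

text \<open>Parents are followed inside the class until \<open>D i\<close> or a piece is reached,
  which does not change the root; at most one attaching edge remains.\<close>

lemma reach_piece:
  assumes i: "i \<in> I" and "(x, x) \<in> Q i"
  shows "\<exists>y\<in>(\<Union>k. Y i k). (x, y) \<in> Q i \<and> (r x, r y) \<in> edges\<^sup>*"
  using assms(2)
proof (induction "rk x" arbitrary: x rule: less_induct)
  case less
  consider "x \<in> (\<Union>k. Y i k)" | "x \<in> D i" "x \<notin> (\<Union>k. Y i k)" | "x \<notin> D i" by blast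
  then show ?case
  proof cases
    case 1
    then show ?thesis using less.prems by blast
  next
    case 2
    have "(r x, r (q i x)) \<in> edges\<^sup>*"
    proof (cases "r x = r (q i x)")
      case False
      then have "(r x, r (q i x)) \<in> edges"
        using 2 i by (auto simp: edges_def edge_rel_def)
      then show ?thesis by blast
    qed simp
    then show ?thesis using q[OF i 2] by blast
  next
    case 3
    note px = not_D[OF i less.prems 3]
    have "(par x, par x) \<in> Q i" using px Q_refl i by blast
    then obtain y where y: "y \<in> (\<Union>k. Y i k)" "(par x, y) \<in> Q i" "(r (par x), r y) \<in> edges\<^sup>*"
      using less.hyps[OF px(5)] by blast
    have "(x, y) \<in> Q i" using y(2) px(4) trans_Q[OF i] by (meson transD)
    then show ?thesis using y r_par[OF px(1,2)] by auto
  qed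
qed

text \<open>A step of \<open>Q i\<close> becomes a detour: both ends move into pieces along
  \<open>edges\<close>, and by \<open>Y_class\<close> they arrive in the same piece.\<close>

lemma kurosh_generates:
  assumes "(x, y) \<in> (\<Union>i\<in>I. Q i)\<^sup>*"
  shows "(r x, r y) \<in> ((\<Union>i\<in>I. \<Union>k\<in>{k. Y i k \<noteq> {}}. map_prod r r ` S i k) \<union> edges)\<^sup>*" (is "_ \<in> ?H\<^sup>*")
  using assms
proof (induction rule: rtrancl_induct)
  case (step y z)
  then obtain i where i: "i \<in> I" "(y, z) \<in> Q i" by blast
  obtain u where u: "u \<in> (\<Union>k. Y i k)" "(y, u) \<in> Q i" "(r y, r u) \<in> edges\<^sup>*"
    using reach_piece Q_refl i by metis
  obtain w where w: "w \<in> (\<Union>k. Y i k)" "(z, w) \<in> Q i" "(r z, r w) \<in> edges\<^sup>*"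
    using reach_piece Q_refl i by metis
  have uw: "(u, w) \<in> Q i"
    using i u(2) w(2) sym_Q[OF i(1)] trans_Q[OF i(1)] by (meson symD transD)
  obtain k where k: "u \<in> Y i k" using u by blast
  then have "w \<in> Y i k" using w Y_class[OF i(1) uw k] by blast
  then have "(r u, r w) \<in> map_prod r r ` S i k" using uw k by (auto simp: S_def)
  moreover have "map_prod r r ` S i k \<subseteq> (\<Union>k\<in>{k. Y i k \<noteq> {}}. map_prod r r ` S i k)"
    using k by (intro UN_upper) auto
  then have "map_prod r r ` S i k \<subseteq> ?H" using i(1) by (meson UN_upper le_supI1 order_trans)
  ultimately have 1: "(r u, r w) \<in> ?H" by (rule subsetD[rotated])
  have "edges\<^sup>* \<subseteq> ?H\<^sup>*" by (rule rtrancl_mono) blast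
  moreover have "(r w, r z) \<in> edges\<^sup>*" using w(3) sym_rtrancl[OF sym_edges] by (meson symD)
  ultimately have "(r y, r u) \<in> ?H\<^sup>*" "(r w, r z) \<in> ?H\<^sup>*" using u(3) by blast+
  with 1 step.IH show ?case by (meson rtrancl_into_rtrancl rtrancl_trans)
qed simp

end

section \<open>The Borel construction\<close>

locale kurosh_borel =
  fixes M :: "'a measure" and R :: "'a rel" and I :: "'i set" and dom :: "'i \<Rightarrow> 'a set"
    and Ri :: "'i \<Rightarrow> 'a rel" and A :: "'a set" and f :: "nat \<Rightarrow> 'a \<Rightarrow> 'a"
  assumes standard: "standard_borel_space M"
    and R_equiv: "borel_equiv_on M (space M) R"
    and sub: "i \<in> I \<Longrightarrow> sub_relation M R (dom i) (Ri i)"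
    and product: "countable_free_product (space M) I Ri R"
    and A_sets [measurable]: "A \<in> sets M"
    and f_meas [measurable]: "f n \<in> measurable M M"
    and f_0: "f 0 x = x"
    and f_R: "x \<in> space M \<Longrightarrow> (x, y) \<in> R \<longleftrightarrow> (\<exists>n. y = f n x)"
begin

lemma countable_I: "countable I"
  using product by (simp add: countable_free_product_def)

lemma R_sub: "R \<subseteq> space M \<times> space M"
  using R_equiv by (auto simp: borel_equiv_on_def equiv_def refl_on_def)

lemma R_refl: "x \<in> space M \<Longrightarrow> (x, x) \<in> R"
  using R_equiv by (auto simp: borel_equiv_on_def equiv_def refl_on_def)

lemma R_sym: "(x, y) \<in> R \<Longrightarrow> (y, x) \<in> R"
  using R_equiv by (auto simp: borel_equiv_on_def equiv_def dest: symD)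

lemma R_trans: "(x, y) \<in> R \<Longrightarrow> (y, z) \<in> R \<Longrightarrow> (x, z) \<in> R"
  using R_equiv by (auto simp: borel_equiv_on_def equiv_def dest: transD)

lemma A_space: "A \<subseteq> space M"
  using A_sets by (rule sets.sets_into_space)

lemma Ri:
  assumes "i \<in> I"
  shows "dom i \<in> sets M" "Ri i \<in> sets (M \<Otimes>\<^sub>M M)" "Ri i \<subseteq> R" "Ri i \<subseteq> dom i \<times> dom i"
    and "x \<in> dom i \<Longrightarrow> (x, x) \<in> Ri i"
    and "(x, y) \<in> Ri i \<Longrightarrow> (y, x) \<in> Ri i"
    and "(x, y) \<in> Ri i \<Longrightarrow> (y, z) \<in> Ri i \<Longrightarrow> (x, z) \<in> Ri i"
  using sub[OF assms] unfolding sub_relation_def borel_equiv_on_def equiv_def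
  by (auto simp: refl_on_def dest: symD transD)

lemma pred_Bex_I:
  assumes "\<And>i. i \<in> I \<Longrightarrow> Measurable.pred N (P i)"
  shows "Measurable.pred N (\<lambda>x. \<exists>i\<in>I. P i x)"
proof -
  have "{x \<in> space N. P i x} \<in> sets N" if "i \<in> I" for i
    using assms[OF that] by (simp add: pred_def)
  then have "(\<Union>i\<in>I. {x \<in> space N. P i x}) \<in> sets N"
    by (rule sets.countable_UN''[OF countable_I])
  moreover have "(\<Union>i\<in>I. {x \<in> space N. P i x}) = {x \<in> space N. \<exists>i\<in>I. P i x}" by auto
  ultimately show ?thesis by (simp add: pred_def)
qed

lemma pred_Ri_f:
  assumes "i \<in> I"
  shows "Measurable.pred M (\<lambda>x. (x, f l x) \<in> Ri i)"
proof -
  note Ri(2)[OF assms, measurable]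
  show ?thesis by measurable
qed

lemma pred_eq:
  "g \<in> measurable N M \<Longrightarrow> h \<in> measurable N M \<Longrightarrow> Measurable.pred N (\<lambda>x. g x = h x)"
  by (rule pred_standard_borel_eq[OF standard])

section \<open>Levels, parents and roots\<close>

primrec lev :: "nat \<Rightarrow> 'a set" where
  "lev 0 = A"
| "lev (Suc m) = {x \<in> space M. \<exists>i\<in>I. \<exists>l. (x, f l x) \<in> Ri i \<and> f l x \<in> lev m}"

lemma lev_sets [measurable]: "lev m \<in> sets M"
proof (induction m)
  case (Suc m)
  note Suc[measurable]
  have "Measurable.pred M (\<lambda>x. \<exists>i\<in>I. \<exists>l. (x, f l x) \<in> Ri i \<and> f l x \<in> lev m)"
  proof (rule pred_Bex_I)
    fix i assume "i \<in> I"
    note pred_Ri_f[OF this, measurable]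
    show "Measurable.pred M (\<lambda>x. \<exists>l. (x, f l x) \<in> Ri i \<and> f l x \<in> lev m)" by measurable
  qed
  then show ?case by (simp add: pred_def)
qed simp

definition X where "X = saturation R A"

lemma X_iff: "x \<in> X \<longleftrightarrow> x \<in> space M \<and> (\<exists>n. f n x \<in> A)"
proof
  assume "x \<in> X"
  then obtain a where a: "a \<in> A" "(a, x) \<in> R" by (auto simp: X_def saturation_def)
  then have "(x, a) \<in> R" "x \<in> space M" using R_sym R_sub by auto
  then show "x \<in> space M \<and> (\<exists>n. f n x \<in> A)" using a(1) f_R by auto
next
  assume "x \<in> space M \<and> (\<exists>n. f n x \<in> A)"
  then show "x \<in> X" using f_R R_sym by (fastforce simp: X_def saturation_def)
qed

lemma X_space: "X \<subseteq> space M"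
  by (auto simp: X_iff)

lemma X_sets [measurable]: "X \<in> sets M"
proof -
  have "X = {x \<in> space M. \<exists>n. f n x \<in> A}" by (auto simp: X_iff)
  also have "\<dots> \<in> sets M" by measurable
  finally show ?thesis .
qed

lemma A_X: "A \<subseteq> X"
  using A_space R_refl by (auto simp: X_def saturation_def)

lemma X_R: "x \<in> X \<Longrightarrow> (x, y) \<in> R \<Longrightarrow> y \<in> X"
  using R_trans by (auto simp: X_def saturation_def)

lemma R_generated: "R \<subseteq> (\<Union>i\<in>I. Ri i)\<^sup>*"
proof (rule countable_free_product_generates[OF product])
  fix i assume i: "i \<in> I"
  show "Ri i \<subseteq> space M \<times> space M" using Ri(3)[OF i] R_sub by blast
  show "sym (Ri i)" using Ri(6)[OF i] by (auto intro: symI)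
qed

definition rk where "rk x = (LEAST m. x \<in> lev m)"

lemma X_lev: "x \<in> X \<Longrightarrow> \<exists>m. x \<in> lev m"
proof -
  assume "x \<in> X"
  then obtain a where a: "a \<in> A" "(x, a) \<in> R" using R_sym by (auto simp: X_def saturation_def)
  then have "(x, a) \<in> (\<Union>i\<in>I. Ri i)\<^sup>*" using R_generated by blast
  then show ?thesis
  proof (induction rule: converse_rtrancl_induct)
    case base
    show ?case using a(1) by (intro exI[of _ 0]) simp
  next
    case (step x y)
    then obtain i m where im: "i \<in> I" "(x, y) \<in> Ri i" "y \<in> lev m" by blast
    then have R: "(x, y) \<in> R" using Ri(3) by blast
    then have x: "x \<in> space M" using R_sub by blast
    then obtain l where "y = f l x" using R f_R by blast
    then have "x \<in> lev (Suc m)" using im x by auto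
    then show ?case ..
  qed
qed

lemma rk_lev: "x \<in> X \<Longrightarrow> x \<in> lev (rk x)"
  unfolding rk_def using X_lev by (rule LeastI_ex)

lemma rk_le: "x \<in> lev m \<Longrightarrow> rk x \<le> m"
  unfolding rk_def by (rule Least_le)

lemma rk_meas [measurable]: "rk \<in> measurable M (count_space UNIV)"
  unfolding rk_def by measurable

definition enum where "enum = from_nat_into I"

text \<open>Class and parent are chosen together as the least code of a suitable pair, since a least
  number over Borel conditions is Borel. The test for \<open>I\<close> covers the arbitrary value of
  \<open>enum\<close> when \<open>I\<close> is empty.\<close>

definition code where
  "code x = (LEAST c. enum (fst (prod_decode c)) \<in> I \<and>
     (x, f (snd (prod_decode c)) x) \<in> Ri (enum (fst (prod_decode c))) \<and>
     (\<exists>m. rk x = Suc m \<and> f (snd (prod_decode c)) x \<in> lev m))"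

lemma code_meas [measurable]: "code \<in> measurable M (count_space UNIV)"
proof -
  have [measurable]: "Measurable.pred M (\<lambda>x. enum a \<in> I \<and> (x, f l x) \<in> Ri (enum a))" for a l
    using pred_Ri_f[of "enum a" l] by (cases "enum a \<in> I") simp_all
  show ?thesis unfolding code_def conj_assoc[symmetric] by measurable
qed

definition cl where "cl x = enum (fst (prod_decode (code x)))"

definition par where "par x = f (snd (prod_decode (code x))) x"

lemma par_meas [measurable]: "par \<in> measurable M M"
  unfolding par_def by (rule measurable_compose_countable[where f="\<lambda>c. f (snd (prod_decode c))"]) measurable

lemma par:
  assumes "x \<in> X" "x \<notin> A"
  shows "cl x \<in> I" "(x, par x) \<in> Ri (cl x)" "rk (par x) < rk x"
proof -
  have "rk x \<noteq> 0" using rk_lev[OF assms(1)] assms(2) by (metis lev.simps(1))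
  then obtain m where m: "rk x = Suc m" by (metis not0_implies_Suc)
  then have "x \<in> lev (Suc m)" using rk_lev[OF assms(1)] by simp
  then obtain i l where il: "i \<in> I" "(x, f l x) \<in> Ri i" "f l x \<in> lev m" by auto
  obtain a where a: "enum a = i"
    using from_nat_into_surj[OF countable_I il(1)] by (auto simp: enum_def)
  have "\<exists>c. enum (fst (prod_decode c)) \<in> I \<and>
     (x, f (snd (prod_decode c)) x) \<in> Ri (enum (fst (prod_decode c))) \<and>
     (\<exists>m. rk x = Suc m \<and> f (snd (prod_decode c)) x \<in> lev m)"
    by (rule exI[of _ "prod_encode (a, l)"]) (use a il m in simp)
  then have "enum (fst (prod_decode (code x))) \<in> I \<and>
     (x, f (snd (prod_decode (code x))) x) \<in> Ri (enum (fst (prod_decode (code x)))) \<and>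
     (\<exists>m. rk x = Suc m \<and> f (snd (prod_decode (code x))) x \<in> lev m)"
    unfolding code_def by (rule LeastI_ex)
  then show "cl x \<in> I" "(x, par x) \<in> Ri (cl x)" "rk (par x) < rk x"
    unfolding cl_def[symmetric] par_def[symmetric] by (auto dest: rk_le)
qed

lemma par_X: "x \<in> X \<Longrightarrow> x \<notin> A \<Longrightarrow> par x \<in> X"
  using par(1,2) Ri(3) X_R by blast

definition up where "up x = (if x \<in> A then x else par x)"

text \<open>\<open>rk x\<close> iterations suffice on \<open>X\<close>, as each parent lowers
  \<open>rk\<close> and points of \<open>A\<close> are fixed. The exponent takes countably many
  values, which keeps the map Borel.\<close>

definition rt where "rt x = (up ^^ rk x) x"

lemma rt_meas [measurable]: "rt \<in> measurable M M"
proof -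
  have up [measurable]: "up \<in> measurable M M" unfolding up_def by measurable
  have "(up ^^ n) \<in> measurable M M" for n
  proof (induction n)
    case (Suc n)
    then show ?case using measurable_comp[OF Suc up] by simp
  qed (simp add: id_def)
  then show ?thesis unfolding rt_def by (rule measurable_compose_countable) measurable
qed

lemma up_iterate: "x \<in> X \<Longrightarrow> rk x \<le> n \<Longrightarrow> (up ^^ n) x = rt x \<and> rt x \<in> A"
proof (induction n arbitrary: x rule: less_induct)
  case (less n)
  have fix_A: "(up ^^ k) a = a" if "a \<in> A" for a k
    by (induction k) (simp_all add: up_def that)
  show ?case
  proof (cases "x \<in> A")
    case True
    then show ?thesis by (simp add: fix_A rt_def)
  next
    case False
    note px = par[OF less.prems(1) False]
    obtain m k where mk: "n = Suc m" "rk x = Suc k" using px(3) less.prems(2) by (metis Suc_le_D not0_implies_Suc not_less0)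
    have "(up ^^ m) (par x) = rt (par x) \<and> rt (par x) \<in> A"
      using less.IH[of m "par x"] par_X[OF less.prems(1) False] mk px(3) less.prems(2) by simp
    moreover have "(up ^^ k) (par x) = rt (par x)"
      using less.IH[of k "par x"] par_X[OF less.prems(1) False] mk px(3) less.prems(2) by simp
    moreover have "(up ^^ Suc j) x = (up ^^ j) (par x)" for j
      using False by (simp add: funpow_Suc_right up_def[of x] del: funpow.simps)
    ultimately show ?thesis
      unfolding rt_def[of x] mk by simp
  qed
qed

lemma rt_A: "x \<in> A \<Longrightarrow> rt x = x"
proof -
  assume "x \<in> A"
  then have "rk x = 0" using rk_le[of x 0] by simp
  then show ?thesis by (simp add: rt_def)
qed

lemma rt_in_A: "x \<in> X \<Longrightarrow> rt x \<in> A"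
  using up_iterate[of x "rk x"] by simp

lemma rt_par:
  assumes "x \<in> X" "x \<notin> A"
  shows "rt x = rt (par x)"
proof -
  obtain k where k: "rk x = Suc k" using par(3)[OF assms] by (metis not0_implies_Suc not_less0)
  then have "rt x = (up ^^ k) (par x)"
    using assms(2) by (simp add: rt_def[of x] funpow_Suc_right up_def[of x] del: funpow.simps)
  then show ?thesis using up_iterate[of "par x" k] par_X[OF assms] par(3)[OF assms] k by simp
qed

lemma rt_R: "x \<in> X \<Longrightarrow> (x, rt x) \<in> R"
proof (induction "rk x" arbitrary: x rule: less_induct)
  case less
  show ?case
  proof (cases "x \<in> A")
    case True
    then show ?thesis using rt_A R_refl A_space by auto
  next
    case False
    have "(x, par x) \<in> R" using par(1,2)[OF less.prems False] Ri(3) by blast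
    moreover have "(par x, rt (par x)) \<in> R"
      using less.hyps par(3)[OF less.prems False] par_X[OF less.prems False] by blast
    ultimately show ?thesis using rt_par[OF less.prems False] R_trans by metis
  qed
qed

section \<open>The pieces inside each class\<close>

definition D where "D i = {x \<in> dom i \<inter> X. x \<in> A \<or> cl x \<noteq> i}"

definition V where "V i k = {x \<in> D i. f k (rt x) = x}"

definition \<kappa> where "\<kappa> i x = (LEAST k. \<exists>m. (x, f m x) \<in> Ri i \<and> f m x \<in> V i k)"

definition Y where "Y i k = {x \<in> V i k. \<kappa> i x = k}"

definition q where "q i x = f (LEAST m. (x, f m x) \<in> Ri i \<and> (\<exists>k. f m x \<in> Y i k)) x"

context
  fixes i assumes i: "i \<in> I"
begin

lemma D_sets [measurable]: "D i \<in> sets M"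
proof -
  note Ri(1)[OF i, measurable]
  have [measurable]: "Measurable.pred M (\<lambda>x. cl x \<noteq> i)"
    unfolding cl_def by (rule measurable_compose[OF code_meas]) simp
  have "D i = {x \<in> space M. x \<in> dom i \<and> x \<in> X \<and> (x \<in> A \<or> cl x \<noteq> i)}"
    using X_space by (auto simp: D_def)
  also have "\<dots> \<in> sets M" by measurable
  finally show ?thesis .
qed

lemma V_sets [measurable]: "V i k \<in> sets M"
proof -
  have [measurable]: "Measurable.pred M (\<lambda>x. f k (rt x) = x)" by (rule pred_eq) measurable
  have "V i k = {x \<in> space M. x \<in> D i \<and> f k (rt x) = x}"
    using X_space by (auto simp: V_def D_def)
  also have "\<dots> \<in> sets M" by measurable
  finally show ?thesis .
qed

lemma \<kappa>_meas [measurable]: "\<kappa> i \<in> measurable M (count_space UNIV)"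
proof -
  note pred_Ri_f[OF i, measurable]
  show ?thesis unfolding \<kappa>_def by measurable
qed

lemma Y_sets [measurable]: "Y i k \<in> sets M"
proof -
  have "Y i k = {x \<in> space M. x \<in> V i k \<and> \<kappa> i x = k}"
    using X_space by (auto simp: Y_def V_def D_def)
  also have "\<dots> \<in> sets M" by measurable
  finally show ?thesis .
qed

lemma q_meas [measurable]: "q i \<in> measurable M M"
proof -
  note pred_Ri_f[OF i, measurable]
  have "(\<lambda>x. LEAST m. (x, f m x) \<in> Ri i \<and> (\<exists>k. f m x \<in> Y i k)) \<in> measurable M (count_space UNIV)"
    by measurable
  from measurable_compose_countable[OF f_meas this] show ?thesis unfolding q_def .
qed

text \<open>The maps \<open>f m\<close> enumerate the \<open>R\<close>-class of \<open>x\<close>, so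
  definitions by an index \<open>m\<close>, which are visibly Borel, agree with those that quantify
  over points.\<close>

lemma Ri_f: "x \<in> dom i \<Longrightarrow> (\<exists>m. (x, f m x) \<in> Ri i \<and> P (f m x)) \<longleftrightarrow> (\<exists>y. (x, y) \<in> Ri i \<and> P y)"
proof -
  assume "x \<in> dom i"
  then have x: "x \<in> space M" using sets.sets_into_space[OF Ri(1)[OF i]] by blast
  have "(x, y) \<in> Ri i \<Longrightarrow> \<exists>m. y = f m x" for y using Ri(3)[OF i] f_R[OF x] by blast
  then show ?thesis by metis
qed

lemma \<kappa>_eq: "x \<in> dom i \<Longrightarrow> \<kappa> i x = (LEAST k. \<exists>y. (x, y) \<in> Ri i \<and> y \<in> V i k)"
  unfolding \<kappa>_def by (subst Ri_f) simp_all

lemma \<kappa>_cong: "(x, y) \<in> Ri i \<Longrightarrow> \<kappa> i x = \<kappa> i y"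
proof -
  assume xy: "(x, y) \<in> Ri i"
  then have "(\<exists>z. (x, z) \<in> Ri i \<and> z \<in> V i k) \<longleftrightarrow> (\<exists>z. (y, z) \<in> Ri i \<and> z \<in> V i k)" for k
    using Ri(6,7)[OF i] by blast
  moreover have "x \<in> dom i" "y \<in> dom i" using xy Ri(4)[OF i] by auto
  ultimately show ?thesis by (simp add: \<kappa>_eq)
qed

text \<open>Outside \<open>D i\<close> the parent stays in the same \<open>Ri i\<close>-class and
  lowers \<open>rk\<close>, so following parents ends in \<open>D i\<close>.\<close>

lemma meets_D: "x \<in> dom i \<inter> X \<Longrightarrow> \<exists>y\<in>D i. (x, y) \<in> Ri i"
proof (induction "rk x" arbitrary: x rule: less_induct)
  case less
  show ?case
  proof (cases "x \<in> D i")
    case True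
    then show ?thesis using less.prems Ri(5)[OF i] by blast
  next
    case False
    then have x: "x \<in> X" "x \<notin> A" "cl x = i" using less.prems by (auto simp: D_def)
    then have "(x, par x) \<in> Ri i" "rk (par x) < rk x" "par x \<in> X" using par[OF x(1,2)] par_X by auto
    moreover have "par x \<in> dom i" using \<open>(x, par x) \<in> Ri i\<close> Ri(4)[OF i] by auto
    ultimately obtain y where "y \<in> D i" "(par x, y) \<in> Ri i" using less.hyps by blast
    then show ?thesis using \<open>(x, par x) \<in> Ri i\<close> Ri(7)[OF i] by blast
  qed
qed

text \<open>The class contains a point of \<open>D i\<close>, which some \<open>f k\<close> recovers
  from its root, so the minimum defining \<open>\<kappa>\<close> is attained.\<close>

lemma meets_Y:
  assumes "x \<in> dom i \<inter> X"
  shows "\<exists>y\<in>Y i (\<kappa> i x). (x, y) \<in> Ri i"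
proof -
  obtain y where y: "y \<in> D i" "(x, y) \<in> Ri i" using meets_D[OF assms] by blast
  then have "y \<in> X" by (simp add: D_def)
  then obtain k where "y = f k (rt y)"
    using rt_R R_sym f_R rt_in_A A_space by (metis subsetD)
  then have "y \<in> V i k" using y by (simp add: V_def)
  then have "\<exists>k y. (x, y) \<in> Ri i \<and> y \<in> V i k" using y by blast
  then have "\<exists>y. (x, y) \<in> Ri i \<and> y \<in> V i (\<kappa> i x)"
    using assms unfolding \<kappa>_eq[OF IntD1[OF assms]] by (rule_tac LeastI_ex) blast
  then obtain z where "(x, z) \<in> Ri i" "z \<in> V i (\<kappa> i x)" by blast
  then show ?thesis using \<kappa>_cong by (intro bexI[of _ z]) (simp_all add: Y_def)
qed

lemma q_Y:
  assumes "x \<in> dom i \<inter> X"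
  shows "(x, q i x) \<in> Ri i \<and> q i x \<in> (\<Union>k. Y i k)"
proof -
  have "\<exists>y. (x, y) \<in> Ri i \<and> (\<exists>k. y \<in> Y i k)" using meets_Y[OF assms] by blast
  then have "\<exists>m. (x, f m x) \<in> Ri i \<and> (\<exists>k. f m x \<in> Y i k)"
    using Ri_f[of x "\<lambda>y. \<exists>k. y \<in> Y i k"] assms by blast
  from LeastI_ex[OF this] show ?thesis by (simp add: q_def)
qed

lemma Y_V_D: "Y i k \<subseteq> V i k" "V i k \<subseteq> D i" "D i \<subseteq> dom i \<inter> X"
  by (auto simp: Y_def V_def D_def)

lemma Y_dom: "Y i k \<subseteq> dom i \<inter> X"
  by (auto simp: Y_def V_def D_def)

text \<open>Since \<open>f 0\<close> is the identity, \<open>V i 0\<close> consists of the points of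
  \<open>D i\<close> that are their own root, namely those in \<open>A\<close>, and their classes
  have \<open>\<kappa>\<close> equal to 0.\<close>

lemma Y_0: "Y i 0 = dom i \<inter> A"
proof
  show "Y i 0 \<subseteq> dom i \<inter> A"
    using rt_in_A by (fastforce simp: Y_def V_def D_def f_0)
  show "dom i \<inter> A \<subseteq> Y i 0"
  proof
    fix x assume x: "x \<in> dom i \<inter> A"
    then have V: "x \<in> V i 0" using A_X by (auto simp: V_def D_def f_0 rt_A)
    then have "\<kappa> i x = 0"
      using x Ri(5)[OF i] by (subst \<kappa>_eq) (auto intro!: Least_equality)
    then show "x \<in> Y i 0" using V by (simp add: Y_def)
  qed
qed

text \<open>\<open>\<kappa> i\<close> is constant on classes, so the saturations are its level sets;
  this makes them Borel and disjoint.\<close>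

lemma saturation_Y: "saturation (Ri i) (Y i k) = {x \<in> dom i \<inter> X. \<kappa> i x = k}"
proof
  show "saturation (Ri i) (Y i k) \<subseteq> {x \<in> dom i \<inter> X. \<kappa> i x = k}"
  proof
    fix x assume "x \<in> saturation (Ri i) (Y i k)"
    then obtain y where y: "y \<in> Y i k" "(y, x) \<in> Ri i" by (auto simp: saturation_def)
    moreover have "y \<in> X" using y(1) Y_V_D by blast
    ultimately show "x \<in> {x \<in> dom i \<inter> X. \<kappa> i x = k}"
      using \<kappa>_cong[of y x] Ri(3,4)[OF i] X_R[of y x] by (auto simp: Y_def)
  qed
  show "{x \<in> dom i \<inter> X. \<kappa> i x = k} \<subseteq> saturation (Ri i) (Y i k)"
    using meets_Y Ri(6)[OF i] by (fastforce simp: saturation_def)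
qed

end

text \<open>Roots in \<open>A\<close> are available only on \<open>X\<close>; as \<open>X\<close> is
  \<open>R\<close>-invariant, the restriction cuts no class in two.\<close>

definition Q where "Q i = Ri i \<inter> X \<times> X"

lemma Q_refl_iff: "i \<in> I \<Longrightarrow> (x, x) \<in> Q i \<longleftrightarrow> x \<in> dom i \<inter> X"
  using Ri(4,5) by (auto simp: Q_def)

sublocale kurosh_data I Q X A par cl rk rt D Y q
proof
  show "free_family I Q"
    by (rule free_family_mono[OF free_family_of_countable_free_product[OF product]]) (auto simp: Q_def)
  show "A \<subseteq> X" by (rule A_X)
  show "cl x \<in> I \<and> (x, par x) \<in> Q (cl x) \<and> rk (par x) < rk x" if "x \<in> X" "x \<notin> A" for x
    using par[OF that] par_X[OF that] that by (simp add: Q_def)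
  show "x \<in> A \<Longrightarrow> rt x = x" for x by (rule rt_A)
  show "x \<in> X \<Longrightarrow> x \<notin> A \<Longrightarrow> rt x = rt (par x)" for x by (rule rt_par)
  fix i assume i: "i \<in> I"
  show "sym (Q i)" using Ri(6)[OF i] by (auto simp: Q_def sym_def)
  show "trans (Q i)" using Ri(7)[OF i] by (auto simp: Q_def trans_def)
  show "Q i \<subseteq> X \<times> X" by (auto simp: Q_def)
  show "D i = {x. (x, x) \<in> Q i \<and> (x \<in> A \<or> cl x \<noteq> i)}"
    by (auto simp: D_def Q_refl_iff[OF i])
  show "Y i k \<subseteq> D i" for k using Y_V_D[OF i] by blast
  show "k = k'" if "(y, y') \<in> Q i" "y \<in> Y i k" "y' \<in> Y i k'" for y y' k k'
    using that \<kappa>_cong[OF i, of y y'] by (auto simp: Q_def Y_def)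
  show "inj_on rt (Y i k)" for k
  proof (rule inj_onI)
    fix x y assume "x \<in> Y i k" "y \<in> Y i k" "rt x = rt y"
    then have "f k (rt x) = x" "f k (rt y) = y" by (simp_all add: Y_def V_def)
    then show "x = y" using \<open>rt x = rt y\<close> by metis
  qed
  show "(x, q i x) \<in> Q i \<and> q i x \<in> (\<Union>k. Y i k)" if "x \<in> D i" for x
  proof -
    have x: "x \<in> dom i \<inter> X" using that Y_V_D(3)[OF i] by blast
    have "q i x \<in> X" using X_R[of x "q i x"] x q_Y[OF i x] Ri(3)[OF i] by blast
    then show ?thesis using q_Y[OF i x] x by (simp add: Q_def)
  qed
qed

text \<open>The image of \<open>Y i k\<close> under \<open>rt\<close>, written as a preimage by
  means of the inverse \<open>f k\<close> so that it is visibly Borel.\<close>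

definition source where "source i k = {a \<in> A. f k a \<in> Y i k \<and> rt (f k a) = a}"

definition piece_rel where
  "piece_rel i k = pullback_rel (f k) (source i k) (restrict_rel (Ri i) (f k ` source i k))"

context
  fixes i assumes i: "i \<in> I"
begin

lemma source_image: "f k ` source i k = Y i k"
proof
  show "f k ` source i k \<subseteq> Y i k" by (auto simp: source_def)
  show "Y i k \<subseteq> f k ` source i k"
  proof
    fix y assume y: "y \<in> Y i k"
    then have "f k (rt y) = y" "y \<in> X" using Y_V_D[OF i] by (auto simp: Y_def V_def)
    then show "y \<in> f k ` source i k"
      using y rt_in_A by (intro image_eqI[of _ _ "rt y"]) (simp_all add: source_def)
  qed
qed

lemma rt_source: "y \<in> Y i k \<Longrightarrow> rt y \<in> source i k \<and> f k (rt y) = y"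
  using rt_in_A Y_V_D[OF i] by (fastforce simp: source_def Y_def V_def)

lemma source_sets [measurable]: "source i k \<in> sets M"
proof -
  have [measurable]: "Measurable.pred M (\<lambda>a. rt (f k a) = a)" by (rule pred_eq) measurable
  note Y_sets[OF i, measurable]
  have "source i k = {a \<in> space M. a \<in> A \<and> f k a \<in> Y i k \<and> rt (f k a) = a}"
    using A_space by (auto simp: source_def)
  also have "\<dots> \<in> sets M" by measurable
  finally show ?thesis .
qed

lemma source_A: "source i k \<subseteq> A"
  by (auto simp: source_def)

lemma inj_source: "inj_on (f k) (source i k)"
  by (rule inj_on_inverseI[of _ rt]) (simp add: source_def)

lemma pseudogroup: "full_pseudogroup M R (source i k) (f k ` source i k) (f k)"
  unfolding full_pseudogroup_def
proof (intro conjI ballI)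
  show "source i k \<in> sets M" by (rule source_sets)
  show "f k ` source i k \<in> sets M" using Y_sets[OF i] by (simp add: source_image)
  show "bij_betw (f k) (source i k) (f k ` source i k)" using inj_source by (rule inj_on_imp_bij_betw)
  show "f k \<in> measurable (restrict_space M (source i k)) (restrict_space M (f k ` source i k))"
    by (rule measurable_restrict_space3[OF f_meas]) auto
  have "rt \<in> measurable (restrict_space M (f k ` source i k)) (restrict_space M (source i k))"
    by (rule measurable_restrict_space3[OF rt_meas]) (use rt_source source_image in auto)
  moreover have "inv_into (source i k) (f k) y = rt y" if "y \<in> space (restrict_space M (f k ` source i k))" for y
  proof -
    have "y \<in> Y i k" using that by (simp add: space_restrict_space source_image)
    then show ?thesis using rt_source inj_source by (intro inv_into_f_eq) auto
  qed
  ultimately show "inv_into (source i k) (f k) \<in>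
      measurable (restrict_space M (f k ` source i k)) (restrict_space M (source i k))"
    by (simp cong: measurable_cong)
  show "(x, f k x) \<in> R" if "x \<in> source i k" for x
    using that source_A A_space f_R by blast
qed

lemma piece_rel_iff:
  "(x, y) \<in> piece_rel i k \<longleftrightarrow> x \<in> source i k \<and> y \<in> source i k \<and> (f k x, f k y) \<in> Ri i"
  by (auto simp: piece_rel_def pullback_rel_def restrict_rel_def)

text \<open>Links the pullback required by the theorem with the collapsed piece of
  \<open>kurosh_data\<close>: \<open>rt\<close> and \<open>f k\<close> are mutually inverse between
  \<open>Y i k\<close> and \<open>source i k\<close>.\<close>

lemma piece_rel_eq: "piece_rel i k = map_prod rt rt ` S i k"
proof
  show "piece_rel i k \<subseteq> map_prod rt rt ` S i k"
  proof
    fix z assume "z \<in> piece_rel i k"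
    then obtain x y where z: "z = (x, y)" "x \<in> source i k" "y \<in> source i k" "(f k x, f k y) \<in> Ri i"
      by (cases z) (simp add: piece_rel_iff)
    then have "f k x \<in> Y i k" "f k y \<in> Y i k" "rt (f k x) = x" "rt (f k y) = y"
      by (simp_all add: source_def)
    moreover from this have "(f k x, f k y) \<in> S i k"
      using z(4) Y_dom[OF i, of k] by (auto simp: S_def Q_def)
    ultimately show "z \<in> map_prod rt rt ` S i k"
      using z(1) by (metis map_prod_simp rev_image_eqI)
  qed
  show "map_prod rt rt ` S i k \<subseteq> piece_rel i k"
    using rt_source by (auto simp: S_def Q_def piece_rel_iff)
qed

lemma sub_relation_piece: "sub_relation M (restrict_rel R A) (source i k) (piece_rel i k)"
  unfolding sub_relation_def borel_equiv_on_def
proof (intro conjI)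
  show "source i k \<in> sets M" by (rule source_sets)
  note Ri(2)[OF i, measurable] source_sets[measurable]
  have "piece_rel i k = {z \<in> space (M \<Otimes>\<^sub>M M). fst z \<in> source i k \<and> snd z \<in> source i k \<and>
      (f k (fst z), f k (snd z)) \<in> Ri i}"
    using source_A[of k] A_space by (auto simp: piece_rel_iff space_pair_measure)
  also have "\<dots> \<in> sets (M \<Otimes>\<^sub>M M)" by measurable
  finally show "piece_rel i k \<in> sets (M \<Otimes>\<^sub>M M)" .
  have "source i k \<subseteq> {x. f k x \<in> dom i}" using Y_dom[OF i, of k] by (auto simp: source_def)
  then show "equiv (source i k) (piece_rel i k)"
    unfolding equiv_def
  proof (intro conjI)
    show "sym (piece_rel i k)" using Ri(6)[OF i] by (simp add: sym_def piece_rel_iff)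
    show "trans (piece_rel i k)" using Ri(7)[OF i] unfolding trans_def piece_rel_iff by blast
  qed (use Ri(5)[OF i] in \<open>auto simp: refl_on_def piece_rel_iff\<close>)
  show "piece_rel i k \<subseteq> restrict_rel R A"
  proof
    fix z assume "z \<in> piece_rel i k"
    then obtain x y where z: "z = (x, y)" "x \<in> source i k" "y \<in> source i k" "(f k x, f k y) \<in> Ri i"
      by (cases z) (simp add: piece_rel_iff)
    have "(x, f k x) \<in> R" "(y, f k y) \<in> R" using z(2,3) source_A A_space f_R by blast+
    then have "(x, y) \<in> R" using z(4) Ri(3)[OF i] R_trans R_sym by blast
    then show "z \<in> restrict_rel R A" using z source_A by (auto simp: restrict_rel_def)
  qed
qed

lemma piece_partition:
  "countable_borel_partition M (dom i \<inter> saturation R A) {k. Y i k \<noteq> {}}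
     (\<lambda>k. saturation (Ri i) (f k ` source i k))"
  unfolding countable_borel_partition_def source_image saturation_Y[OF i] X_def[symmetric]
proof (intro conjI ballI)
  fix k assume "k \<in> {k. Y i k \<noteq> {}}"
  then obtain y where y: "y \<in> Y i k" by auto
  then show "{x \<in> dom i \<inter> X. \<kappa> i x = k} \<noteq> {}"
    using Y_V_D[OF i] by (fastforce simp: Y_def)
  note Ri(1)[OF i, measurable] \<kappa>_meas[OF i, measurable]
  have "{x \<in> dom i \<inter> X. \<kappa> i x = k} = {x \<in> space M. x \<in> dom i \<and> x \<in> X \<and> \<kappa> i x = k}"
    using X_space by auto
  also have "\<dots> \<in> sets M" by measurable
  finally show "{x \<in> dom i \<inter> X. \<kappa> i x = k} \<in> sets M" .
next
  show "disjoint_family_on (\<lambda>k. {x \<in> dom i \<inter> X. \<kappa> i x = k}) {k. Y i k \<noteq> {}}"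
    by (auto simp: disjoint_family_on_def)
  show "(\<Union>k\<in>{k. Y i k \<noteq> {}}. {x \<in> dom i \<inter> X. \<kappa> i x = k}) = dom i \<inter> X"
    using meets_Y[OF i] by fastforce
qed simp

lemma piece_0:
  "source i 0 = dom i \<inter> A" "piece_rel i 0 = restrict_rel (Ri i) (dom i \<inter> A)"
proof -
  show source_0: "source i 0 = dom i \<inter> A" by (auto simp: source_def f_0 Y_0[OF i] rt_A)
  show "piece_rel i 0 = restrict_rel (Ri i) (dom i \<inter> A)"
  proof (rule set_eqI)
    fix z :: "'a \<times> 'a"
    obtain x y where z: "z = (x, y)" by (cases z)
    show "z \<in> piece_rel i 0 \<longleftrightarrow> z \<in> restrict_rel (Ri i) (dom i \<inter> A)"
      unfolding z piece_rel_iff source_0 f_0 by (auto simp: restrict_rel_def)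
  qed
qed

end

section \<open>The treeable factor\<close>

definition T where "T = edges\<^sup>* \<inter> A \<times> A"

lemma edges_R: "edges \<subseteq> R"
proof -
  have "(rt x, rt (q i x)) \<in> R \<and> (rt (q i x), rt x) \<in> R" if "i \<in> I" "x \<in> D i" for i x
  proof -
    have x: "x \<in> dom i \<inter> X" using Y_V_D(3)[OF that(1)] that(2) by blast
    have xq: "(x, q i x) \<in> R" using q_Y[OF that(1) x] Ri(3)[OF that(1)] by blast
    then have "q i x \<in> X" using X_R x by blast
    then show ?thesis using xq rt_R x R_sym R_trans by (meson IntD2)
  qed
  moreover have "rt x \<in> space M" if "i \<in> I" "x \<in> D i" for i x
    using that Y_V_D(3)[OF that(1)] rt_in_A A_space by blast
  ultimately show ?thesis
    by (auto simp: edges_def edge_rel_def)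
qed

text \<open>\<open>edges\<close> is defined through an image under \<open>rt\<close>, but a point
  \<open>x\<close> with root \<open>a\<close> is some \<open>f m a\<close>, so the quantifier over
  \<open>x\<close> becomes one over \<open>m\<close>.\<close>

lemma edges_sets [measurable]: "edges \<in> sets (M \<Otimes>\<^sub>M M)"
proof -
  define P where "P a b \<longleftrightarrow> (\<exists>i\<in>I. \<exists>m. f m a \<in> D i - (\<Union>k. Y i k) \<and> rt (f m a) = a \<and> rt (q i (f m a)) = b)" for a b
  have P_iff: "P a b \<longleftrightarrow> (\<exists>i\<in>I. \<exists>x\<in>D i - (\<Union>k. Y i k). rt x = a \<and> rt (q i x) = b)" for a b
  proof
    assume "\<exists>i\<in>I. \<exists>x\<in>D i - (\<Union>k. Y i k). rt x = a \<and> rt (q i x) = b"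
    then obtain i x where ix: "i \<in> I" "x \<in> D i - (\<Union>k. Y i k)" "rt x = a" "rt (q i x) = b" by blast
    then have "x \<in> X" using Y_V_D(3) by blast
    then have "(a, x) \<in> R" "a \<in> space M" using rt_R R_sym rt_in_A A_space ix(3) by blast+
    then obtain m where "x = f m a" using f_R by blast
    then show "P a b" using ix unfolding P_def by blast
  qed (auto simp: P_def)
  have "Measurable.pred (M \<Otimes>\<^sub>M M) (\<lambda>z. P (fst z) (snd z))"
    unfolding P_def
  proof (rule pred_Bex_I)
    fix i assume i: "i \<in> I"
    note q_meas[OF i, measurable]
    have E: "(\<Union>k. Y i k) \<in> sets M" using Y_sets[OF i] by (intro sets.countable_UN'') auto
    have "Measurable.pred (M \<Otimes>\<^sub>M M) (\<lambda>z. f m (fst z) \<in> D i)"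
      "Measurable.pred (M \<Otimes>\<^sub>M M) (\<lambda>z. f m (fst z) \<in> (\<Union>k. Y i k))" for m
      by (rule pred_sets2[OF D_sets[OF i]] pred_sets2[OF E]; measurable)+
    moreover have "Measurable.pred (M \<Otimes>\<^sub>M M) (\<lambda>z. rt (f m (fst z)) = fst z)"
      "Measurable.pred (M \<Otimes>\<^sub>M M) (\<lambda>z. rt (q i (f m (fst z))) = snd z)" for m
      by (rule pred_eq; measurable)+
    ultimately show "Measurable.pred (M \<Otimes>\<^sub>M M) (\<lambda>z. \<exists>m. f m (fst z) \<in> D i - (\<Union>k. Y i k) \<and>
        rt (f m (fst z)) = fst z \<and> rt (q i (f m (fst z))) = snd z)"
      by (intro pred_intros_countable pred_intros_logic)
  qed
  note P1 [measurable] = this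
  have [measurable]: "Measurable.pred (M \<Otimes>\<^sub>M M) (\<lambda>z. P (snd z) (fst z))"
    using measurable_compose[OF measurable_pair_swap' P1] by (simp add: case_prod_beta')
  have [measurable]: "Measurable.pred (M \<Otimes>\<^sub>M M) (\<lambda>z. fst z = snd z)"
    by (rule standard_borel_diagonal[OF standard])
  have "edges = {z \<in> space (M \<Otimes>\<^sub>M M). \<not> fst z = snd z \<and> (P (fst z) (snd z) \<or> P (snd z) (fst z))}"
  proof (rule set_eqI)
    fix z :: "'a \<times> 'a"
    obtain a b where z: "z = (a, b)" by (cases z)
    have ends: "(a, b) \<in> edge_rel u v \<longleftrightarrow> (u = a \<and> v = b) \<or> (u = b \<and> v = a)" if "a \<noteq> b" for u v
      using that by (auto simp: edge_rel_def)
    have "(a, b) \<in> edges \<longleftrightarrow> a \<noteq> b \<and> (P a b \<or> P b a)"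
    proof (cases "a = b")
      case False
      have "(a, b) \<in> edges \<longleftrightarrow>
          (\<exists>i\<in>I. \<exists>x\<in>D i - (\<Union>k. Y i k). (rt x = a \<and> rt (q i x) = b) \<or> (rt x = b \<and> rt (q i x) = a))"
        using False by (simp add: edges_def ends)
      also have "\<dots> \<longleftrightarrow> P a b \<or> P b a" unfolding P_iff by blast
      finally show ?thesis using False by simp
    qed (simp add: edges_def)
    moreover have "(a, b) \<in> edges \<Longrightarrow> (a, b) \<in> space M \<times> space M" using edges_sub A_space by blast
    ultimately show "z \<in> edges \<longleftrightarrow>
        z \<in> {z \<in> space (M \<Otimes>\<^sub>M M). \<not> fst z = snd z \<and> (P (fst z) (snd z) \<or> P (snd z) (fst z))}"
      unfolding z mem_Collect_eq space_pair_measure fst_conv snd_conv by metis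
  qed
  also have "\<dots> \<in> sets (M \<Otimes>\<^sub>M M)" by measurable
  finally show ?thesis .
qed

text \<open>Intermediate vertices are named as \<open>f m\<close> of the start, which turns
  reachability into a countable union of Borel sets.\<close>

primrec walks :: "nat \<Rightarrow> 'a \<times> 'a \<Rightarrow> bool" where
  "walks 0 z \<longleftrightarrow> fst z = snd z"
| "walks (Suc n) z \<longleftrightarrow> (\<exists>m. walks n (fst z, f m (fst z)) \<and> (f m (fst z), snd z) \<in> edges)"

lemma walks_meas [measurable]: "Measurable.pred (M \<Otimes>\<^sub>M M) (walks n)"
proof (induction n)
  case 0
  show ?case using standard_borel_diagonal[OF standard] by simp
next
  case (Suc n)
  note Suc[measurable]
  show ?case unfolding walks.simps(2)[abs_def] by measurable
qed

lemma T_R: "T \<subseteq> R"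
proof -
  have "(x, y) \<in> R" if "(x, y) \<in> edges\<^sup>*" "x \<in> A" for x y
    using that
  proof (induction rule: rtrancl_induct)
    case base
    then show ?case using R_refl A_space by blast
  next
    case (step y z)
    then show ?case using edges_R R_trans by blast
  qed
  then show ?thesis by (auto simp: T_def)
qed

lemma T_iff_walks: "(x, y) \<in> T \<longleftrightarrow> x \<in> A \<and> y \<in> A \<and> (\<exists>n. walks n (x, y))"
proof -
  have "(\<exists>n. walks n (x, y)) \<longleftrightarrow> (x, y) \<in> edges\<^sup>*" if x: "x \<in> A"
  proof
    assume "\<exists>n. walks n (x, y)"
    then obtain n where "walks n (x, y)" ..
    then show "(x, y) \<in> edges\<^sup>*"
      by (induction n arbitrary: y) (auto intro: rtrancl_into_rtrancl)
  next
    assume "(x, y) \<in> edges\<^sup>*"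
    then show "\<exists>n. walks n (x, y)"
    proof (induction rule: rtrancl_induct)
      case base
      show ?case by (rule exI[of _ 0]) simp
    next
      case (step y z)
      then obtain n where n: "walks n (x, y)" by blast
      have "y \<in> A" using step.hyps(2) edges_sub by blast
      then have "(x, y) \<in> R" using T_R x step.hyps(1) by (auto simp: T_def)
      then obtain m where "y = f m x" using f_R x A_space by blast
      then show ?case using n step.hyps(2) by (intro exI[of _ "Suc n"]) auto
    qed
  qed
  then show ?thesis by (auto simp: T_def)
qed

lemma sub_relation_T: "sub_relation M (restrict_rel R A) A T"
  unfolding sub_relation_def borel_equiv_on_def
proof (intro conjI)
  show "A \<in> sets M" by (rule A_sets)
  have "T = {z \<in> space (M \<Otimes>\<^sub>M M). fst z \<in> A \<and> snd z \<in> A \<and> (\<exists>n. walks n z)}"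
    using A_space T_iff_walks by (auto simp: space_pair_measure)
  also have "\<dots> \<in> sets (M \<Otimes>\<^sub>M M)" by measurable
  finally show "T \<in> sets (M \<Otimes>\<^sub>M M)" .
  show "equiv A T"
    using sym_rtrancl[OF sym_edges] by (auto simp: T_def equiv_def refl_on_def sym_def trans_def)
  show "T \<subseteq> restrict_rel R A" using T_R by (auto simp: T_def restrict_rel_def)
qed

lemma treeable_T: "treeable M A T"
  unfolding treeable_def
proof (intro conjI exI[of _ edges])
  show "borel_equiv_on M A T" using sub_relation_T by (simp add: sub_relation_def)
  show "countable_classes A T"
    unfolding countable_classes_def
  proof
    fix x assume "x \<in> A"
    then have "T `` {x} \<subseteq> range (\<lambda>n. f n x)" using T_R f_R A_space by blast
    then show "countable (T `` {x})" by (rule countable_subset) simp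
  qed
  show "\<forall>x\<in>A. \<forall>y\<in>A. (x, y) \<in> edges\<^sup>* \<longleftrightarrow> (x, y) \<in> T" by (simp add: T_def)
qed (rule edges_sets edges_sub sym_edges irrefl_edges acyclic_edges)+

lemma restricted_product:
  "countable_free_product A (kurosh_index I (\<lambda>i. {k. Y i k \<noteq> {}})) (kurosh_family piece_rel T)
     (restrict_rel R A)"
proof (rule countable_free_productI)
  let ?J = "kurosh_index I (\<lambda>i. {k. Y i k \<noteq> {}})"
  have cong: "kurosh_family piece_rel T j = kurosh_family (\<lambda>i k. map_prod rt rt ` S i k) T j" if "j \<in> ?J" for j
    using that by (auto simp: kurosh_index_def kurosh_family_def piece_rel_eq)
  show "countable ?J" using countable_I by (simp add: kurosh_index_def)
  show "free_family ?J (kurosh_family piece_rel T)"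
    by (rule free_family_mono[OF free_kurosh_family[of T "\<lambda>i. {k. Y i k \<noteq> {}}"]])
      (use cong in \<open>auto simp: T_def\<close>)
  show "equiv A (restrict_rel R A)"
    unfolding equiv_def
  proof (intro conjI)
    show "refl_on A (restrict_rel R A)"
      using A_space R_refl by (auto simp: restrict_rel_def refl_on_def)
    show "sym (restrict_rel R A)" using R_sym by (auto simp: restrict_rel_def intro!: symI)
    show "trans (restrict_rel R A)" using R_trans unfolding restrict_rel_def trans_def by blast
  qed (auto simp: restrict_rel_def)
  show "kurosh_family piece_rel T j \<subseteq> restrict_rel R A" if "j \<in> ?J" for j
  proof (cases j)
    case None
    then show ?thesis using sub_relation_T by (simp add: kurosh_family_def sub_relation_def)
  next
    case (Some p)
    then have "fst p \<in> I" using that by (auto simp: kurosh_index_def)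
    then obtain i k where "p = (i, k)" "i \<in> I" by (cases p) auto
    then show ?thesis
      using sub_relation_piece[of i k] Some by (simp add: kurosh_family_def sub_relation_def)
  qed
  show "restrict_rel R A \<subseteq> (\<Union>j\<in>?J. kurosh_family piece_rel T j)\<^sup>*"
  proof
    fix z assume "z \<in> restrict_rel R A"
    then obtain x y where z: "z = (x, y)" "(x, y) \<in> R" "x \<in> A" "y \<in> A"
      by (auto simp: restrict_rel_def)
    \<comment> \<open>A chain starting in \<open>A\<close> never leaves the
      \<open>R\<close>-invariant set \<open>X\<close>. Hence \<open>kurosh_generates\<close>
      applies, and \<open>rt\<close> fixes both ends.\<close>
    have "(x, y) \<in> (\<Union>i\<in>I. Q i)\<^sup>* \<and> y \<in> X" if "(x, y) \<in> (\<Union>i\<in>I. Ri i)\<^sup>*" for y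
      using that
    proof (induction rule: rtrancl_induct)
      case base
      then show ?case using z(3) A_X by auto
    next
      case (step y w)
      then obtain i where i: "i \<in> I" "(y, w) \<in> Ri i" by blast
      then have "w \<in> X" using step.IH X_R Ri(3) by blast
      then have "(y, w) \<in> (\<Union>i\<in>I. Q i)" using i step.IH by (auto simp: Q_def)
      then show ?case using step.IH \<open>w \<in> X\<close> by (meson rtrancl_into_rtrancl)
    qed
    then have "(x, y) \<in> (\<Union>i\<in>I. Q i)\<^sup>*" using R_generated z(2) by blast
    from kurosh_generates[OF this]
    have xy: "(x, y) \<in> ((\<Union>i\<in>I. \<Union>k\<in>{k. Y i k \<noteq> {}}. map_prod rt rt ` S i k) \<union> edges)\<^sup>*"
      using z(3,4) by (simp add: rt_A)
    have "(\<Union>i\<in>I. \<Union>k\<in>{k. Y i k \<noteq> {}}. map_prod rt rt ` S i k) \<union> edges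
        \<subseteq> (\<Union>j\<in>?J. kurosh_family piece_rel T j)"
    proof (rule Un_least)
      show "edges \<subseteq> (\<Union>j\<in>?J. kurosh_family piece_rel T j)"
        using edges_sub by (auto simp: kurosh_index_def kurosh_family_def T_def)
      show "(\<Union>i\<in>I. \<Union>k\<in>{k. Y i k \<noteq> {}}. map_prod rt rt ` S i k) \<subseteq> (\<Union>j\<in>?J. kurosh_family piece_rel T j)"
      proof (intro UN_least)
        fix i k assume ik: "i \<in> I" "k \<in> {k. Y i k \<noteq> {}}"
        then have "map_prod rt rt ` S i k = kurosh_family piece_rel T (Some (i, k))"
          by (simp add: kurosh_family_def piece_rel_eq)
        then show "map_prod rt rt ` S i k \<subseteq> (\<Union>j\<in>?J. kurosh_family piece_rel T j)"
          using ik by (auto simp: kurosh_index_def)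
      qed
    qed
    from rtrancl_mono[OF this] show "z \<in> (\<Union>j\<in>?J. kurosh_family piece_rel T j)\<^sup>*"
      using xy z(1) by blast
  qed
qed

end

theorem mainTheorem2:
  fixes M :: "'a measure" and R :: "'a rel"
    and I :: "'i set" and dom :: "'i \<Rightarrow> 'a set" and Ri :: "'i \<Rightarrow> 'a rel"
    and A :: "'a set"
  assumes "standard_borel_space M"
    and "borel_equiv_on M (space M) R"
    and "countable_classes (space M) R"
    and "\<And>i. i \<in> I \<Longrightarrow> sub_relation M R (dom i) (Ri i)"
    and "(\<Union>i\<in>I. dom i) = space M"
    and "countable_free_product (space M) I Ri R"
    and "A \<in> sets M"
  shows "\<exists>(K :: 'i \<Rightarrow> nat set) (D :: 'i \<Rightarrow> nat \<Rightarrow> 'a set) (\<phi> :: 'i \<Rightarrow> nat \<Rightarrow> 'a \<Rightarrow> 'a)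
            (S :: 'i \<Rightarrow> nat \<Rightarrow> 'a rel) (B :: 'a set) (T :: 'a rel).
      (\<forall>i\<in>I. \<forall>k\<in>K i.
          sub_relation M (restrict_rel R A) (D i k) (S i k) \<and>
          full_pseudogroup M R (D i k) (\<phi> i k ` D i k) (\<phi> i k) \<and>
          \<phi> i k ` D i k \<subseteq> dom i \<and>
          S i k = pullback_rel (\<phi> i k) (D i k) (restrict_rel (Ri i) (\<phi> i k ` D i k))) \<and>
      sub_relation M (restrict_rel R A) B T \<and> treeable M B T \<and>
      countable_free_product A (kurosh_index I K) (kurosh_family S T) (restrict_rel R A) \<and>
      (\<forall>i\<in>I. countable_borel_partition M (dom i \<inter> saturation R A) (K i)
                (\<lambda>k. saturation (Ri i) (\<phi> i k ` D i k))) \<and>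
      (\<forall>i\<in>I. dom i \<inter> A \<noteq> {} \<longrightarrow>
          (\<exists>k\<in>K i. D i k = dom i \<inter> A \<and> S i k = restrict_rel (Ri i) (dom i \<inter> A)))"
proof (rule countable_borel_equiv_enumeration[OF assms(1-3)])
  fix f :: "nat \<Rightarrow> 'a \<Rightarrow> 'a"
  assume f: "\<And>n. f n \<in> measurable M M" "\<And>x. f 0 x = x"
    "\<And>x y. x \<in> space M \<Longrightarrow> (x, y) \<in> R \<longleftrightarrow> (\<exists>n. y = f n x)"
  interpret kurosh_borel M R I dom Ri A f
    by unfold_locales (fact assms f)+
  \<comment> \<open>The witnesses are \<open>K i = {k. Y i k \<noteq> {}}\<close>, so that no member
    of the partition is empty, the domains \<open>source i k\<close>, the maps \<open>f k\<close>
    for every \<open>i\<close>, the relations \<open>piece_rel i k\<close>, and \<open>B = A\<close>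
    with \<open>T\<close>.\<close>
  show ?thesis
  proof (intro exI conjI ballI impI)
    fix i assume i: "i \<in> I"
    show "sub_relation M (restrict_rel R A) (source i k) (piece_rel i k)" for k
      by (rule sub_relation_piece[OF i])
    show "full_pseudogroup M R (source i k) (f k ` source i k) (f k)" for k
      by (rule pseudogroup[OF i])
    show "f k ` source i k \<subseteq> dom i" for k
      using Y_dom[OF i] by (simp add: source_image[OF i])
    show "piece_rel i k = pullback_rel (f k) (source i k) (restrict_rel (Ri i) (f k ` source i k))" for k
      by (rule piece_rel_def)
    show "countable_borel_partition M (dom i \<inter> saturation R A) {k. Y i k \<noteq> {}}
        (\<lambda>k. saturation (Ri i) (f k ` source i k))"
      by (rule piece_partition[OF i])
    show "\<exists>k\<in>{k. Y i k \<noteq> {}}. source i k = dom i \<inter> A \<and> piece_rel i k = restrict_rel (Ri i) (dom i \<inter> A)"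
      if "dom i \<inter> A \<noteq> {}"
      by (rule bexI[of _ 0]) (use that piece_0[OF i] Y_0[OF i] in auto)
  qed (rule sub_relation_T treeable_T restricted_product)+
qed

end
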